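(* Let $k > t \ge 2$ be fixed integers and let $D = \binom{k}{t} - 1$. The $(v,k,t)$ covering produced by the induced covering algorithm has expected density $$1 + O\bigl( (\log v)^{-1/D} \bigr)$$ as $v \to \infty$.
   Context: A $(v,k,t)$ covering is a family of $k$-subsets, called blocks, of a fixed $v$-set such that every $t$-subset of the $v$-set is contained in at least one block. Its density is the average, over all $t$-subsets, of the number of blocks containing the $t$-subset; equivalently, $(\text{number of blocks}) \cdot \binom{k}{t} / \binom{v}{t}$ (blocks counted with multiplicity). Random greedy $(n,k,t)$ covering algorithm: (1) Fix a uniformly random ordering of all $k$-subsets of an $n$-set. (2) Choose the earliest $k$-set that contains no already-covered $t$-set (a $t$-set is already covered if it is contained in a previously chosen $k$-set). (3) Repeat step (2) until no $k$-set can be chosen. (4) For each still-uncovered $t$-set, add one $k$-set containing it. Induced $(v,k,t)$ covering algorithm: (1) Put $\ell = \frac{1}{9} v^{1-1/t}$ and choose a prime $p$ with $4\ell \le (v-t)/p \le 8\ell$ (such a prime exists by Bertrand's Postulate, and $p^t > v$ for $v$ large). (2) For every integer $\ell'$ with $\ell < \ell' < 9\ell$, precompute an $(\ell',k,t)$ covering using the random greedy covering algorithm, keeping the smallest covering obtained in $r$ independent runs, where $r \ge 1$ and $r = O(\log \ell)$. (3) Choose a uniformly random set $V$ of $v$ points of the affine geometry $\mathrm{AG}(t,p)$ (the $t$-dimensional affine space over the field with $p$ elements). (4) For each (affine) hyperplane $H$ of $\mathrm{AG}(t,p)$, let $\ell' = |H \cap V|$. If $\ell < \ell' < 9\ell$,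 add to the output the blocks of the precomputed $(\ell',k,t)$ covering, placed on the points of $H \cap V$. If $\ell' \le \ell$ or $\ell' \ge 9\ell$, add $\binom{\ell'}{t}$ blocks, namely for each $t$-subset of $H \cap V$ one $k$-subset of $V$ containing it. The output is a $(v,k,t)$ covering on the $v$-set $V$. The expectation is over all random choices of the algorithm; the implied constant may depend on $k$ and $t$. *)

theory Defs
  imports
    "HOL-Probability.Probability"
    "HOL-Library.Ramsey"
    "HOL-Library.Landau_Symbols"
    "HOL-Number_Theory.Number_Theory"
begin

(* nsets X k, from Ramsey, is the set of k-subsets of X. *)

definition is_covering :: "'a set \<Rightarrow> nat \<Rightarrow> nat \<Rightarrow> nat \<Rightarrow> 'a set multiset \<Rightarrow> bool" where
  "is_covering V v k t \<B> \<longleftrightarrow>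
     finite V \<and> card V = v \<and> set_mset \<B> \<subseteq> nsets V k \<and>
     (\<forall>T\<in>nsets V t. \<exists>b\<in>#\<B>. T \<subseteq> b)"

definition covering_density :: "nat \<Rightarrow> 'a set \<Rightarrow> 'a set multiset \<Rightarrow> real" where
  "covering_density t V \<B> =
     (\<Sum>T\<in>nsets V t. real (size {#b \<in># \<B>. T \<subseteq> b#})) / real (card (nsets V t))"

definition covered :: "'a set set \<Rightarrow> 'a set \<Rightarrow> bool" where
  "covered B T \<longleftrightarrow> (\<exists>b\<in>B. T \<subseteq> b)"

definition choosable :: "nat \<Rightarrow> 'a set set \<Rightarrow> 'a set \<Rightarrow> bool" where
  "choosable t B b \<longleftrightarrow> (\<forall>T\<in>nsets b t. \<not> covered B T)"

(* The list \<sigma> is the ordering of the k-sets; B is the set of blocks chosen so far. *)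
inductive greedy_chosen :: "nat \<Rightarrow> 'a set list \<Rightarrow> 'a set set \<Rightarrow> bool" for t \<sigma> where
  start: "greedy_chosen t \<sigma> {}"
| choose: "greedy_chosen t \<sigma> B \<Longrightarrow> List.find (choosable t B) \<sigma> = Some b
    \<Longrightarrow> greedy_chosen t \<sigma> (insert b B)"

definition greedy_finished :: "nat \<Rightarrow> 'a set list \<Rightarrow> 'a set set \<Rightarrow> bool" where
  "greedy_finished t \<sigma> B \<longleftrightarrow> greedy_chosen t \<sigma> B \<and> List.find (choosable t B) \<sigma> = None"

(* The algorithms leave some choices open (for instance which k-set is added for an uncovered
   t-set), so they are relations: the last argument is a possible output for the given values
   of the random variables. *)
definition greedy_covering ::
    "nat \<Rightarrow> nat \<Rightarrow> nat \<Rightarrow> nat set list \<Rightarrow> nat set multiset \<Rightarrow> bool" where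
  "greedy_covering n k t \<sigma> \<B> \<longleftrightarrow>
     (\<exists>B g. greedy_finished t \<sigma> B \<and>
        (let U = {T \<in> nsets {..<n} t. \<not> covered B T} in
           (\<forall>T\<in>U. g T \<in> nsets {..<n} k \<and> T \<subseteq> g T) \<and>
           \<B> = mset_set B + image_mset g (mset_set U)))"

definition best_greedy_covering ::
    "nat \<Rightarrow> nat \<Rightarrow> nat \<Rightarrow> nat \<Rightarrow> (nat \<Rightarrow> nat set list) \<Rightarrow> nat set multiset \<Rightarrow> bool" where
  "best_greedy_covering n k t r \<sigma> \<B> \<longleftrightarrow>
     (\<exists>R. (\<forall>i<r. greedy_covering n k t (\<sigma> i) (R i)) \<and>
        \<B> \<in> R ` {..<r} \<and> (\<forall>i<r. size \<B> \<le> size (R i)))"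

definition AG :: "nat \<Rightarrow> nat \<Rightarrow> (nat \<Rightarrow> nat) set" where
  "AG t p = {..<t} \<rightarrow>\<^sub>E {..<p}"

definition hyperplanes :: "nat \<Rightarrow> nat \<Rightarrow> (nat \<Rightarrow> nat) set set" where
  "hyperplanes t p =
     {{x \<in> AG t p. [(\<Sum>i<t. a i * x i) = b] (mod p)} |a b. \<exists>i<t. \<not> [a i = 0] (mod p)}"

definition ell :: "nat \<Rightarrow> nat \<Rightarrow> real" where
  "ell t v = 1 / 9 * real v powr (1 - 1 / real t)"

definition precomputed_sizes :: "nat \<Rightarrow> nat \<Rightarrow> nat set" where
  "precomputed_sizes t v = {n. ell t v < real n \<and> real n < 9 * ell t v}"

definition admissible_prime :: "nat \<Rightarrow> nat \<Rightarrow> nat \<Rightarrow> bool" where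
  "admissible_prime t v p \<longleftrightarrow> prime p \<and>
     4 * ell t v \<le> (real v - real t) / real p \<and> (real v - real t) / real p \<le> 8 * ell t v"

(* An outcome (\<sigma>, V) consists of the ordering \<sigma> (n, i) used in the i-th greedy run on n points,
   for all n and i, and of the point set V. *)
type_synonym outcome = "(nat \<times> nat \<Rightarrow> nat set list) \<times> (nat \<Rightarrow> nat) set"

definition induced_pmf :: "nat \<Rightarrow> nat \<Rightarrow> nat \<Rightarrow> nat \<Rightarrow> nat \<Rightarrow> outcome pmf" where
  "induced_pmf v k t p r =
     pair_pmf
       (Pi_pmf (precomputed_sizes t v \<times> {..<r}) []
          (\<lambda>(n, i). pmf_of_set (permutations_of_set (nsets {..<n} k))))
       (pmf_of_set (nsets (AG t p) v))"

definition induced_covering ::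
    "nat \<Rightarrow> nat \<Rightarrow> nat \<Rightarrow> nat \<Rightarrow> nat \<Rightarrow> outcome \<Rightarrow> (nat \<Rightarrow> nat) set multiset \<Rightarrow> bool" where
  "induced_covering v k t p r = (\<lambda>(\<sigma>, V) \<B>.
     \<exists>\<C> \<D>.
       (\<forall>n\<in>precomputed_sizes t v. best_greedy_covering n k t r (\<lambda>i. \<sigma> (n, i)) (\<C> n)) \<and>
       (\<forall>H\<in>hyperplanes t p.
          let X = H \<inter> V; n = card X in
          if n \<in> precomputed_sizes t v
          then \<exists>f. bij_betw f {..<n} X \<and> \<D> H = image_mset ((`) f) (\<C> n)
          else \<exists>g. (\<forall>T\<in>nsets X t. g T \<in> nsets V k \<and> T \<subseteq> g T) \<and>
                 \<D> H = image_mset g (mset_set (nsets X t))) \<and>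
       \<B> = (\<Sum>H\<in>hyperplanes t p. \<D> H))"

end

theory Submission
  imports Defs "HOL-Real_Asymp.Real_Asymp"
begin

text \<open>Taking a uniformly random ordering amounts to drawing \<open>k\<close>-sets independently and uniformly
  at random, so the greedy algorithm is a random matching process on the hypergraph whose
  vertices are the \<open>t\<close>-sets and whose edges are the \<open>k\<close>-sets.
  The probability that a vertex is uncovered after \<open>m\<close> draws decreases, in one step, by the
  probability that the next edge contains it and is still available. If the \<open>q\<close> vertices of an edge
  were uncovered independently of each other, this would be the recursion
  \<open>y - \<rho> * y ^ q\<close>, whose solution is at most \<open>(1 + (q - 1) * \<rho> * m) powr (- 1 / (q - 1))\<close>.
  Independence holds up to an error that is a negative power of \<open>n\<close> as long as \<open>\<rho> * m\<close> is at most a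
  small multiple of \<open>ln n\<close>: conditioning on the first draw bounds the covariance of two survival
  events by the chance that this draw influences both of them, and the expected number of vertices
  influenced by a given one is only \<open>(1 + \<rho> * q) ^ m\<close>.

  For the induced covering, the number of \<open>t\<close>-subsets of \<open>V\<close> contained in hyperplanes, counted with
  multiplicity, exceeds the number of all \<open>t\<close>-subsets of \<open>V\<close> in expectation at most by the factor
  \<open>p / (p - 1)\<close>. By Chebyshev's inequality the hyperplanes that meet \<open>V\<close> in an exceptional number
  of points contribute a fraction \<open>O(1 / ell t v)\<close> only, and on all the others the density is that of
  the greedy coverings.\<close>

section \<open>Random greedy matchings in regular hypergraphs\<close>

text \<open>The obstacle is that the recursion for the survival of one vertex involves the joint
  survival of all \<open>q\<close> vertices of an edge and so does not close; the influence
  estimates exist to replace this joint probability by a product. Upper bounds are all that has to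
  be proved, because a covering has density at least 1. This permits ignoring everything after the
  first \<open>L\<close> draws: the uncovered set can only shrink. The exponent
  \<open>D = q - 1\<close> is that of the fluid recursion, and \<open>D\<close> is also the price of
  an uncovered \<open>t\<close>-set: a chosen block accounts for \<open>q\<close> new
  \<open>t\<close>-sets, whereas a block of the completion is charged to a single one, so that an
  uncovered fraction \<open>y\<close> means density \<open>1 + D * y\<close>. This is linear in
  \<open>y\<close>, hence expectations suffice for the greedy runs, and the smallest of several
  coverings is compared with the first. Only the intersection sizes need a second moment. There the
  bias matters: an exceptional hyperplane pays one block for each of its \<open>t\<close>-subsets,
  so what has to be small is the share of \<open>t\<close>-subsets on such hyperplanes, not their
  number.\<close>

lemma sum_permutations_of_set_Cons:
  fixes F :: "'a list \<Rightarrow> real"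
  assumes "finite A" "A \<noteq> {}"
  shows "(\<Sum>\<sigma>\<in>permutations_of_set A. F \<sigma>) = (\<Sum>x\<in>A. \<Sum>\<tau>\<in>permutations_of_set (A - {x}). F (x # \<tau>))"
proof -
  have "(\<Sum>\<sigma>\<in>permutations_of_set A. F \<sigma>) = (\<Sum>x\<in>A. \<Sum>\<sigma>\<in>(#) x ` permutations_of_set (A - {x}). F \<sigma>)"
    unfolding permutations_of_set_nonempty[OF assms(2)] using assms(1)
    by (intro sum.UNION_disjoint) auto
  also have "\<dots> = (\<Sum>x\<in>A. \<Sum>\<tau>\<in>permutations_of_set (A - {x}). F (x # \<tau>))"
    by (intro sum.cong[OF refl]) (simp add: sum.reindex)
  finally show ?thesis .
qed

text \<open>Every ordering of \<open>A - {e}\<close> arises from exactly \<open>card A\<close>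
  orderings of \<open>A\<close>, one for each position of \<open>e\<close>. The induction splits off
  the first element, which is either \<open>e\<close> itself or leaves \<open>n\<close> positions
  for \<open>e\<close> in the rest.\<close>

lemma sum_permutations_of_set_remove1:
  fixes H :: "'a list \<Rightarrow> real"
  assumes "finite A" "e \<in> A"
  shows "(\<Sum>\<sigma>\<in>permutations_of_set A. H (remove1 e \<sigma>)) =
    real (card A) * (\<Sum>\<tau>\<in>permutations_of_set (A - {e}). H \<tau>)"
  using assms
proof (induction "card A" arbitrary: A H)
  case 0
  thus ?case by auto
next
  case (Suc n)
  let ?P = permutations_of_set
  have "(\<Sum>\<sigma>\<in>?P A. H (remove1 e \<sigma>)) = (\<Sum>x\<in>A. \<Sum>\<tau>\<in>?P (A - {x}). H (remove1 e (x # \<tau>)))"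
    using Suc.prems by (intro sum_permutations_of_set_Cons) auto
  also have "\<dots> = (\<Sum>\<tau>\<in>?P (A - {e}). H \<tau>) + (\<Sum>x\<in>A - {e}. \<Sum>\<tau>\<in>?P (A - {x}). H (remove1 e (x # \<tau>)))"
    using Suc.prems by (subst sum.remove[of A e]) auto
  also have "(\<Sum>x\<in>A - {e}. \<Sum>\<tau>\<in>?P (A - {x}). H (remove1 e (x # \<tau>))) =
      (\<Sum>x\<in>A - {e}. \<Sum>\<tau>\<in>?P (A - {x}). H (x # remove1 e \<tau>))"
    by (intro sum.cong refl) auto
  also have "\<dots> = (\<Sum>x\<in>A - {e}. real n * (\<Sum>\<tau>\<in>?P (A - {x} - {e}). H (x # \<tau>)))"
  proof (intro sum.cong refl)
    fix x assume x: "x \<in> A - {e}"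
    have c: "n = card (A - {x})" using Suc x by simp
    show "(\<Sum>\<tau>\<in>?P (A - {x}). H (x # remove1 e \<tau>)) = real n * (\<Sum>\<tau>\<in>?P (A - {x} - {e}). H (x # \<tau>))"
      unfolding c using Suc.prems x by (intro Suc.hyps(1)[OF c, of "\<lambda>\<tau>. H (x # \<tau>)"]) auto
  qed
  also have "\<dots> = real n * (\<Sum>x\<in>A - {e}. \<Sum>\<tau>\<in>?P (A - {e} - {x}). H (x # \<tau>))"
  proof -
    have "A - {x} - {e} = A - {e} - {x}" for x by auto
    thus ?thesis by (simp only: sum_distrib_left)
  qed
  also have "\<dots> = real n * (\<Sum>\<tau>\<in>?P (A - {e}). H \<tau>)"
  proof (cases "A - {e} = {}")
    case True
    hence "card A \<le> card {e}" by (intro card_mono) auto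
    hence "n = 0" using Suc.hyps(2) by simp
    thus ?thesis by simp
  next
    case False
    thus ?thesis using Suc.prems by (simp add: sum_permutations_of_set_Cons)
  qed
  finally show ?case using Suc.hyps(2)[symmetric] by (simp add: algebra_simps)
qed

text \<open>Degrees are measured as fractions of the number of edges: \<rho> is the probability that
  a random edge contains a given vertex, and \<kappa> bounds the probability that it contains two
  given ones. In the application \<kappa> is smaller than \<rho> by a factor of order
  \<open>1 / n\<close>.\<close>

locale regular_hypergraph =
  fixes W :: "'v set" and A :: "'e set" and inc :: "'e \<Rightarrow> 'v set"
    and q :: nat and \<rho> \<kappa> :: real
  assumes finite_W: "finite W" and finite_A: "finite A" and A_nonempty: "A \<noteq> {}"
    and inc_subset: "\<And>e. e \<in> A \<Longrightarrow> inc e \<subseteq> W"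
    and inc_card: "\<And>e. e \<in> A \<Longrightarrow> card (inc e) = q"
    and q_pos: "1 \<le> q"
    and degree: "\<And>S. S \<in> W \<Longrightarrow> real (card {e\<in>A. S \<in> inc e}) = \<rho> * real (card A)"
    and codegree: "\<And>S S'. S \<in> W \<Longrightarrow> S' \<in> W \<Longrightarrow> S \<noteq> S' \<Longrightarrow>
        real (card {e\<in>A. S \<in> inc e \<and> S' \<in> inc e}) \<le> \<kappa> * real (card A)"
    and \<rho>_nonneg: "0 \<le> \<rho>" and \<kappa>_nonneg: "0 \<le> \<kappa>"
begin

definition avg :: "('e \<Rightarrow> real) \<Rightarrow> real" where
  "avg f = (\<Sum>e\<in>A. f e) / real (card A)"

text \<open>The state \<open>C\<close> is the set of vertices covered so far. \<open>run_mean l \<phi> C\<close> is the expectation of \<open>\<phi>\<close>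
  at the state reached from \<open>C\<close> by drawing \<open>l\<close> independent uniformly random edges.\<close>

definition step :: "'e \<Rightarrow> 'v set \<Rightarrow> 'v set" where
  "step e C = (if inc e \<inter> C = {} then C \<union> inc e else C)"

fun run_mean :: "nat \<Rightarrow> ('v set \<Rightarrow> real) \<Rightarrow> 'v set \<Rightarrow> real" where
  "run_mean 0 \<phi> C = \<phi> C"
| "run_mean (Suc l) \<phi> C = avg (\<lambda>e. run_mean l \<phi> (step e C))"

definition survival :: "nat \<Rightarrow> 'v set \<Rightarrow> 'v set \<Rightarrow> real" where
  "survival l C \<T> = run_mean l (\<lambda>C. of_bool (C \<inter> \<T> = {})) C"

text \<open>The expected number of chains of successive edges along which a change of the state at \<open>S\<close> can
  propagate to \<open>T\<close> within \<open>l\<close> draws.\<close>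

fun influence :: "nat \<Rightarrow> 'v \<Rightarrow> 'v \<Rightarrow> real" where
  "influence 0 S T = of_bool (S = T)"
| "influence (Suc l) S T =
     influence l S T + avg (\<lambda>e. of_bool (S \<in> inc e) * (\<Sum>S'\<in>inc e. influence l S' T))"

section \<open>Averages over a random edge\<close>

lemma card_A_pos: "0 < real (card A)"
  using finite_A A_nonempty by (simp add: card_gt_0_iff)

lemma finite_inc: "e \<in> A \<Longrightarrow> finite (inc e)"
  using inc_subset finite_W finite_subset by blast

lemma avg_add: "avg (\<lambda>e. f e + g e) = avg f + avg g"
  by (simp add: avg_def sum.distrib add_divide_distrib)

lemma avg_diff: "avg (\<lambda>e. f e - g e) = avg f - avg g"
  by (simp add: avg_def sum_subtractf diff_divide_distrib)

lemma avg_cmult: "avg (\<lambda>e. c * f e) = c * avg f"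
  by (simp add: avg_def sum_distrib_left)

lemma avg_const: "avg (\<lambda>e. c) = c"
  using card_A_pos by (simp add: avg_def)

lemma avg_mono: "(\<And>e. e \<in> A \<Longrightarrow> f e \<le> g e) \<Longrightarrow> avg f \<le> avg g"
  using card_A_pos unfolding avg_def by (intro divide_right_mono sum_mono) auto

lemma avg_cong: "(\<And>e. e \<in> A \<Longrightarrow> f e = g e) \<Longrightarrow> avg f = avg g"
  unfolding avg_def by (intro arg_cong2[of _ _ _ _ "(/)"] sum.cong) auto

lemma avg_abs: "\<bar>avg f\<bar> \<le> avg (\<lambda>e. \<bar>f e\<bar>)"
  using card_A_pos unfolding avg_def by (auto intro!: divide_right_mono)

lemma avg_nonneg: "(\<And>e. e \<in> A \<Longrightarrow> 0 \<le> f e) \<Longrightarrow> 0 \<le> avg f"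
  using avg_mono[of "\<lambda>_. 0" f] by (simp add: avg_const)

lemma avg_sum: "avg (\<lambda>e. \<Sum>i\<in>I. f i e) = (\<Sum>i\<in>I. avg (f i))"
  by (simp add: avg_def sum_divide_distrib sum.swap[of _ I])

lemma avg_of_bool: "avg (\<lambda>e. of_bool (P e)) = real (card {e\<in>A. P e}) / real (card A)"
proof -
  have "(\<Sum>e\<in>A. of_bool (P e)) = (\<Sum>e\<in>{e\<in>A. P e}. 1 :: real)"
    using finite_A by (intro sum.mono_neutral_cong_right) auto
  thus ?thesis by (simp add: avg_def)
qed

lemma avg_inc_of_bool: "S \<in> W \<Longrightarrow> avg (\<lambda>e. of_bool (S \<in> inc e)) = \<rho>"
  using degree[of S] card_A_pos by (simp add: avg_of_bool)

lemma sum_inc_eq: "e \<in> A \<Longrightarrow> (\<Sum>S\<in>inc e. f S) = (\<Sum>S\<in>W. of_bool (S \<in> inc e) * (f S :: real))"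
  using inc_subset finite_W by (intro sum.mono_neutral_cong_left) auto

lemma avg_inc_sum: "avg (\<lambda>e. \<Sum>S\<in>inc e. f S) = \<rho> * (\<Sum>S\<in>W. f S)"
proof -
  have "avg (\<lambda>e. \<Sum>S\<in>inc e. f S) = avg (\<lambda>e. \<Sum>S\<in>W. f S * of_bool (S \<in> inc e))"
    by (intro avg_cong) (simp add: sum_inc_eq mult.commute)
  also have "\<dots> = (\<Sum>S\<in>W. f S * \<rho>)"
    unfolding avg_sum by (intro sum.cong) (simp_all add: avg_cmult avg_inc_of_bool)
  finally show ?thesis by (simp add: sum_distrib_left mult.commute)
qed

text \<open>Expanding the product gives pairs of vertices of the edge: equal pairs have probability
  \<rho>, distinct ones at most \<kappa>. All uses of the codegree condition go through this
  bound.\<close>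

lemma avg_inc_sum_prod:
  assumes "\<And>S. S \<in> W \<Longrightarrow> 0 \<le> f S" and "\<And>S. S \<in> W \<Longrightarrow> 0 \<le> g S"
  shows "avg (\<lambda>e. (\<Sum>S\<in>inc e. f S) * (\<Sum>S\<in>inc e. g S))
    \<le> \<rho> * (\<Sum>S\<in>W. f S * g S) + \<kappa> * (\<Sum>S\<in>W. f S) * (\<Sum>S\<in>W. g S)"
proof -
  have "avg (\<lambda>e. (\<Sum>S\<in>inc e. f S) * (\<Sum>S\<in>inc e. g S)) =
      avg (\<lambda>e. \<Sum>S\<in>W. \<Sum>S'\<in>W. f S * g S' * of_bool (S \<in> inc e \<and> S' \<in> inc e))"
    by (intro avg_cong) (auto simp: sum_inc_eq sum_product of_bool_conj intro!: sum.cong)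
  also have "\<dots> = (\<Sum>S\<in>W. \<Sum>S'\<in>W. f S * g S' * avg (\<lambda>e. of_bool (S \<in> inc e \<and> S' \<in> inc e)))"
    by (simp only: avg_sum avg_cmult)
  also have "\<dots> \<le> (\<Sum>S\<in>W. \<Sum>S'\<in>W. f S * g S' * (\<rho> * of_bool (S = S') + \<kappa>))"
  proof (intro sum_mono mult_left_mono)
    fix S S' assume SS: "S \<in> W" "S' \<in> W"
    show "avg (\<lambda>e. of_bool (S \<in> inc e \<and> S' \<in> inc e)) \<le> \<rho> * of_bool (S = S') + \<kappa>"
    proof (cases "S = S'")
      case True
      thus ?thesis using SS \<kappa>_nonneg by (simp add: avg_inc_of_bool)
    next
      case False
      thus ?thesis using SS codegree[of S S'] card_A_pos
        by (simp add: avg_of_bool divide_simps)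
    qed
    show "0 \<le> f S * g S'" using SS assms by simp
  qed
  also have "\<dots> = (\<Sum>S\<in>W. \<Sum>S'\<in>W. \<rho> * (f S * g S' * of_bool (S = S'))) + (\<Sum>S\<in>W. \<Sum>S'\<in>W. \<kappa> * (f S * g S'))"
    by (simp add: algebra_simps sum.distrib)
  also have "(\<Sum>S\<in>W. \<Sum>S'\<in>W. \<rho> * (f S * g S' * of_bool (S = S'))) = (\<Sum>S\<in>W. \<rho> * (f S * g S))"
  proof (intro sum.cong refl)
    fix S assume S: "S \<in> W"
    have "(\<Sum>S'\<in>W. \<rho> * (f S * g S' * of_bool (S = S'))) = (\<Sum>S'\<in>W. if S = S' then \<rho> * (f S * g S') else 0)"
      by (intro sum.cong) auto
    thus "(\<Sum>S'\<in>W. \<rho> * (f S * g S' * of_bool (S = S'))) = \<rho> * (f S * g S)"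
      using S finite_W by simp
  qed
  also have "(\<Sum>S\<in>W. \<Sum>S'\<in>W. \<kappa> * (f S * g S')) = \<kappa> * ((\<Sum>S\<in>W. f S) * (\<Sum>S\<in>W. g S))"
    unfolding sum_product by (simp only: sum_distrib_left)
  finally show ?thesis by (simp only: sum_distrib_left[symmetric] mult.assoc)
qed

section \<open>Total and off-diagonal influence\<close>

lemma influence_nonneg: "0 \<le> influence l S T"
  by (induction l arbitrary: S) (auto intro!: add_nonneg_nonneg avg_nonneg sum_nonneg)

text \<open>A chain can be extended by an edge through its current vertex, which has probability
  \<rho>, to any of the \<open>q\<close> vertices of that edge. So each draw multiplies the total by
  \<open>1 + \<rho> * q\<close>.\<close>

lemma influence_sum:
  assumes "T \<in> W"
  shows "(\<Sum>S\<in>W. influence l S T) = (1 + \<rho> * q) ^ l"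
proof (induction l)
  case 0
  have "(\<Sum>S\<in>W. influence 0 S T) = (\<Sum>S\<in>W. if S = T then 1 else 0)"
    by (intro sum.cong) auto
  thus ?case using assms finite_W by simp
next
  case (Suc l)
  have "(\<Sum>S\<in>W. avg (\<lambda>e. of_bool (S \<in> inc e) * (\<Sum>S'\<in>inc e. influence l S' T))) =
      avg (\<lambda>e. real q * (\<Sum>S'\<in>inc e. influence l S' T))"
    unfolding avg_sum[symmetric]
  proof (intro avg_cong)
    fix e assume e: "e \<in> A"
    show "(\<Sum>S\<in>W. of_bool (S \<in> inc e) * (\<Sum>S'\<in>inc e. influence l S' T)) = real q * (\<Sum>S'\<in>inc e. influence l S' T)"
      using sum_inc_eq[OF e, of "\<lambda>_. \<Sum>S'\<in>inc e. influence l S' T"] inc_card[OF e] by simp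
  qed
  also have "\<dots> = real q * (\<rho> * (1 + \<rho> * q) ^ l)"
    by (simp add: avg_cmult avg_inc_sum Suc.IH)
  finally show ?case by (simp add: sum.distrib Suc.IH algebra_simps)
qed

lemma growth_ge_1: "1 \<le> (1 + \<rho> * real q) ^ l"
  using \<rho>_nonneg by (intro one_le_power) auto

lemma growth_mono: "l \<le> l' \<Longrightarrow> (1 + \<rho> * real q) ^ l \<le> (1 + \<rho> * real q) ^ l'"
  using \<rho>_nonneg by (intro power_increasing) auto

text \<open>A first edge through \<open>S\<close> either continues the chain at \<open>S\<close>
  itself, with weight \<rho>, or at another vertex, with weight at most \<kappa> against the total
  influence. As the chain must leave \<open>S\<close> at some draw, a factor \<kappa> appears, once
  for each of the \<open>l\<close> possible draws.\<close>

lemma influence_off_diagonal: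
  assumes "S \<in> W" "T \<in> W" "S \<noteq> T"
  shows "influence l S T \<le> real l * \<kappa> * (1 + \<rho> * q) ^ l"
proof (induction l)
  case 0
  thus ?case using assms by simp
next
  case (Suc l)
  let ?G = "(1 + \<rho> * real q) ^ l"
  have sum1: "(\<Sum>S'\<in>W. of_bool (S' = S) * g S') = g S" for g :: "'v \<Rightarrow> real"
  proof -
    have "(\<Sum>S'\<in>W. of_bool (S' = S) * g S') = (\<Sum>S'\<in>W. if S' = S then g S' else 0)"
      by (intro sum.cong) auto
    thus ?thesis using assms finite_W by simp
  qed
  \<comment> \<open>The indicator of \<open>S\<close> is written as a sum over the edge to bring the
    average into the form of \<open>avg_inc_sum_prod\<close>.\<close>
  have "avg (\<lambda>e. of_bool (S \<in> inc e) * (\<Sum>S'\<in>inc e. influence l S' T)) =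
      avg (\<lambda>e. (\<Sum>S'\<in>inc e. of_bool (S' = S)) * (\<Sum>S'\<in>inc e. influence l S' T))"
  proof (intro avg_cong)
    fix e assume e: "e \<in> A"
    have "(\<Sum>S'\<in>inc e. of_bool (S' = S)) = (\<Sum>S'\<in>inc e. if S' = S then 1 else 0 :: real)"
      by (intro sum.cong) auto
    also have "\<dots> = of_bool (S \<in> inc e)" using finite_inc[OF e] by simp
    finally show "of_bool (S \<in> inc e) * (\<Sum>S'\<in>inc e. influence l S' T) =
      (\<Sum>S'\<in>inc e. of_bool (S' = S)) * (\<Sum>S'\<in>inc e. influence l S' T)" by simp
  qed
  also have "\<dots> \<le> \<rho> * (\<Sum>S'\<in>W. of_bool (S' = S) * influence l S' T) +
      \<kappa> * (\<Sum>S'\<in>W. of_bool (S' = S)) * (\<Sum>S'\<in>W. influence l S' T)"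
    by (intro avg_inc_sum_prod) (auto simp: influence_nonneg)
  also have "\<dots> = \<rho> * influence l S T + \<kappa> * ?G"
    using sum1[of "\<lambda>_. 1"] sum1[of "\<lambda>S'. influence l S' T"] assms by (simp add: influence_sum)
  finally have "influence (Suc l) S T \<le> (1 + \<rho>) * influence l S T + \<kappa> * ?G"
    by (simp add: algebra_simps)
  also have "\<dots> \<le> (1 + \<rho> * q) * (real l * \<kappa> * ?G) + (1 + \<rho> * q) * (\<kappa> * ?G)"
  proof (rule add_mono)
    show "(1 + \<rho>) * influence l S T \<le> (1 + \<rho> * q) * (real l * \<kappa> * ?G)"
      using q_pos \<rho>_nonneg Suc.IH
      by (intro mult_mono) (auto simp: influence_nonneg mult_le_cancel_left1)
    show "\<kappa> * ?G \<le> (1 + \<rho> * q) * (\<kappa> * ?G)"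
      using \<rho>_nonneg \<kappa>_nonneg mult_right_mono[of 1 "1 + \<rho> * real q" "\<kappa> * ?G"] by simp
  qed
  finally show ?case by (simp add: algebra_simps)
qed

section \<open>Survival probabilities and their approximate independence\<close>

lemma step_subset: "e \<in> A \<Longrightarrow> C \<subseteq> W \<Longrightarrow> step e C \<subseteq> W"
  using inc_subset by (auto simp: step_def)

lemma run_mean_in_unit_interval:
  assumes "\<And>C. \<phi> C \<in> {0..1}"
  shows "run_mean l \<phi> C \<in> {0..1}"
proof (induction l arbitrary: C)
  case (Suc l)
  show ?case using avg_mono[of "\<lambda>e. run_mean l \<phi> (step e C)" "\<lambda>_. 1"] Suc
    by (auto simp: avg_const intro!: avg_nonneg)
qed (use assms in auto)

lemma survival_in_unit_interval: "0 \<le> survival l C \<T>" "survival l C \<T> \<le> 1"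
  using run_mean_in_unit_interval[of "\<lambda>C. of_bool (C \<inter> \<T> = {})" l C] by (auto simp: survival_def)

lemma survival_Suc: "survival (Suc l) C \<T> = avg (\<lambda>e. survival l (step e C) \<T>)"
  by (simp add: survival_def)

text \<open>Coupling: run the process from both states with the same draws. An edge that avoids the
  difference of the states is accepted in both runs or in neither, so the difference does not grow.
  An edge that meets it may be accepted in one run only, and then the difference grows at most by
  that edge. The recursion of \<open>influence\<close> is the expectation of exactly this
  growth.\<close>

lemma survival_lipschitz:
  assumes "finite \<T>" "C \<subseteq> W" "C' \<subseteq> W"
  shows "\<bar>survival l C \<T> - survival l C' \<T>\<bar> \<le> (\<Sum>S\<in>(C - C') \<union> (C' - C). \<Sum>T\<in>\<T>. influence l S T)"
  using assms(2,3)
proof (induction l arbitrary: C C')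
  case 0
  let ?D = "(C - C') \<union> (C' - C)"
  have fin: "finite ?D" using 0 finite_W finite_subset by blast
  show ?case
  proof (cases "(C \<inter> \<T> = {}) = (C' \<inter> \<T> = {})")
    case True
    thus ?thesis by (auto simp: survival_def intro!: sum_nonneg)
  next
    case False
    then obtain T where T: "T \<in> \<T>" "T \<in> ?D" by blast
    have "1 \<le> (\<Sum>S\<in>{T}. \<Sum>T\<in>{T}. influence 0 S T)" by simp
    also have "\<dots> \<le> (\<Sum>S\<in>{T}. \<Sum>T\<in>\<T>. influence 0 S T)"
      using T assms(1) by (intro sum_mono sum_mono2) auto
    also have "\<dots> \<le> (\<Sum>S\<in>?D. \<Sum>T\<in>\<T>. influence 0 S T)"
      using T fin by (intro sum_mono2) (auto intro!: sum_nonneg)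
    finally have "1 \<le> (\<Sum>S\<in>?D. \<Sum>T\<in>\<T>. influence 0 S T)" .
    moreover have "\<bar>survival 0 C \<T> - survival 0 C' \<T>\<bar> \<le> 1" by (simp add: survival_def)
    ultimately show ?thesis by linarith
  qed
next
  case (Suc l)
  let ?D = "(C - C') \<union> (C' - C)" and ?g = "\<lambda>S. \<Sum>T\<in>\<T>. influence l S T"
  have fin: "finite ?D" using Suc.prems finite_W finite_subset by blast
  have g0: "0 \<le> ?g S" for S by (intro sum_nonneg) (simp add: influence_nonneg)
  have "\<bar>survival (Suc l) C \<T> - survival (Suc l) C' \<T>\<bar> \<le>
      avg (\<lambda>e. \<bar>survival l (step e C) \<T> - survival l (step e C') \<T>\<bar>)"
    unfolding survival_Suc avg_diff[symmetric] by (rule avg_abs)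
  also have "\<dots> \<le> avg (\<lambda>e. (\<Sum>S\<in>?D. ?g S) + (\<Sum>S\<in>?D. of_bool (S \<in> inc e) * (\<Sum>S'\<in>inc e. ?g S')))"
  proof (rule avg_mono)
    fix e assume e: "e \<in> A"
    let ?D' = "(step e C - step e C') \<union> (step e C' - step e C)"
    have "\<bar>survival l (step e C) \<T> - survival l (step e C') \<T>\<bar> \<le> (\<Sum>S\<in>?D'. ?g S)"
      using Suc.IH step_subset[OF e] Suc.prems by blast
    also have "\<dots> \<le> (\<Sum>S\<in>?D. ?g S) + (\<Sum>S\<in>?D. of_bool (S \<in> inc e) * (\<Sum>S'\<in>inc e. ?g S'))"
    proof (cases "inc e \<inter> ?D = {}")
      case True
      hence "?D' \<subseteq> ?D" by (auto simp: step_def)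
      hence "(\<Sum>S\<in>?D'. ?g S) \<le> (\<Sum>S\<in>?D. ?g S)"
        using fin g0 by (intro sum_mono2) auto
      moreover have "0 \<le> (\<Sum>S\<in>?D. of_bool (S \<in> inc e) * (\<Sum>S'\<in>inc e. ?g S'))"
        by (intro sum_nonneg mult_nonneg_nonneg) (auto simp: influence_nonneg)
      ultimately show ?thesis by linarith
    next
      case False
      then obtain S0 where S0: "S0 \<in> inc e" "S0 \<in> ?D" by blast
      have "?D' \<subseteq> ?D \<union> inc e" by (auto simp: step_def split: if_splits)
      hence "(\<Sum>S\<in>?D'. ?g S) \<le> (\<Sum>S\<in>?D \<union> inc e. ?g S)"
        using fin g0 finite_inc[OF e] by (intro sum_mono2) auto
      also have "\<dots> \<le> (\<Sum>S\<in>?D. ?g S) + (\<Sum>S'\<in>inc e. ?g S')"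
        using fin finite_inc[OF e] sum_nonneg[of "?D \<inter> inc e" ?g] g0 by (simp add: sum_Un)
      \<comment> \<open>The new difference is charged to a single vertex \<open>S0\<close> that the
        edge shares with the old one.\<close>
      also have "(\<Sum>S'\<in>inc e. ?g S') = (\<Sum>S\<in>{S0}. of_bool (S \<in> inc e) * (\<Sum>S'\<in>inc e. ?g S'))"
        using S0 by simp
      also have "\<dots> \<le> (\<Sum>S\<in>?D. of_bool (S \<in> inc e) * (\<Sum>S'\<in>inc e. ?g S'))"
        using fin S0 g0 by (intro sum_mono2) (auto intro!: sum_nonneg influence_nonneg)
      finally show ?thesis by linarith
    qed
    finally show "\<bar>survival l (step e C) \<T> - survival l (step e C') \<T>\<bar> \<le> \<dots>" .
  qed
  also have "\<dots> = (\<Sum>S\<in>?D. ?g S) + (\<Sum>S\<in>?D. avg (\<lambda>e. of_bool (S \<in> inc e) * (\<Sum>S'\<in>inc e. ?g S')))"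
    by (simp add: avg_add avg_const avg_sum)
  also have "\<dots> = (\<Sum>S\<in>?D. \<Sum>T\<in>\<T>. influence (Suc l) S T)"
  proof -
    have "avg (\<lambda>e. of_bool (S \<in> inc e) * (\<Sum>S'\<in>inc e. ?g S')) =
        (\<Sum>T\<in>\<T>. avg (\<lambda>e. of_bool (S \<in> inc e) * (\<Sum>S'\<in>inc e. influence l S' T)))" for S
      unfolding avg_sum[symmetric] sum_distrib_left[symmetric]
      by (intro avg_cong) (simp add: sum.swap[of _ \<T>])
    thus ?thesis by (simp add: sum.distrib)
  qed
  finally show ?case .
qed

text \<open>A covariance is unchanged when constants are subtracted, and \<open>a\<close> and
  \<open>b\<close> need not be the averages. This allows centring at the value before the draw, from
  which one draw deviates only through its own edge.\<close>

lemma avg_covariance: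
  assumes "\<And>e. e \<in> A \<Longrightarrow> \<bar>x e - a\<bar> \<le> \<xi> e" and "\<And>e. e \<in> A \<Longrightarrow> \<bar>y e - b\<bar> \<le> \<upsilon> e"
  shows "\<bar>avg (\<lambda>e. x e * y e) - avg x * avg y\<bar> \<le> avg (\<lambda>e. \<xi> e * \<upsilon> e) + avg \<xi> * avg \<upsilon>"
proof -
  let ?x = "\<lambda>e. x e - a" and ?y = "\<lambda>e. y e - b"
  have "avg (\<lambda>e. ?x e * ?y e) = avg (\<lambda>e. x e * y e) - b * avg x - a * avg y + a * b"
  proof -
    have "avg (\<lambda>e. ?x e * ?y e) = avg (\<lambda>e. (x e * y e - b * x e) - (a * y e - a * b))"
      by (intro avg_cong) (simp add: algebra_simps)
    thus ?thesis by (simp add: avg_diff avg_cmult avg_const)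
  qed
  hence "avg (\<lambda>e. x e * y e) - avg x * avg y = avg (\<lambda>e. ?x e * ?y e) - avg ?x * avg ?y"
    by (simp add: avg_diff avg_const algebra_simps)
  moreover have "\<bar>avg (\<lambda>e. ?x e * ?y e)\<bar> \<le> avg (\<lambda>e. \<xi> e * \<upsilon> e)"
  proof (rule order.trans[OF avg_abs avg_mono])
    fix e assume e: "e \<in> A"
    show "\<bar>?x e * ?y e\<bar> \<le> \<xi> e * \<upsilon> e" unfolding abs_mult
      using assms[OF e] by (intro mult_mono) auto
  qed
  moreover have "\<bar>avg ?x * avg ?y\<bar> \<le> avg \<xi> * avg \<upsilon>" unfolding abs_mult
  proof (intro mult_mono)
    show "\<bar>avg ?x\<bar> \<le> avg \<xi>" by (rule order.trans[OF avg_abs avg_mono]) (rule assms)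
    show "\<bar>avg ?y\<bar> \<le> avg \<upsilon>" by (rule order.trans[OF avg_abs avg_mono]) (rule assms)
    show "0 \<le> avg \<xi>" by (rule avg_nonneg) (meson abs_ge_zero assms(1) order_trans)
  qed auto
  ultimately show ?thesis by linarith
qed

text \<open>The covariance created by one draw, per vertex of the other set. The two factors of
  growth are the total influences on the two sides. The term
  \<open>2 * \<rho> * L * \<kappa>\<close> comes from one vertex of the edge influencing both sides,
  \<kappa> from two different vertices of the edge, and \<open>\<rho>\<^sup>2\<close> from the
  product of the averages.\<close>

definition cov_bound :: "nat \<Rightarrow> real" where
  "cov_bound L = ((1 + \<rho> * q) ^ L)\<^sup>2 * (\<kappa> * (2 * \<rho> * L + 1) + \<rho>\<^sup>2)"

text \<open>Law of total covariance, conditioning on the first draw: the conditional covariance is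
  the induction hypothesis for \<open>l\<close> draws, and the covariance of the two conditional
  probabilities is at most \<open>card \<T> * cov_bound L\<close>. Keeping \<open>L\<close> fixed
  makes this second bound the same for all \<open>l\<close>.\<close>

lemma survival_almost_independent:
  assumes "\<T> \<subseteq> W" "T \<in> W" "T \<notin> \<T>" "l \<le> L" "C \<subseteq> W"
  shows "\<bar>survival l C (insert T \<T>) - survival l C \<T> * survival l C {T}\<bar> \<le> real (card \<T>) * real l * cov_bound L"
  using assms(4,5)
proof (induction l arbitrary: C)
  case 0
  thus ?case by (auto simp: survival_def)
next
  case (Suc l)
  have fT: "finite \<T>" using assms(1) finite_W finite_subset by blast
  define G where "G = (1 + \<rho> * real q) ^ L"
  have G1: "1 \<le> G" and Gl: "(1 + \<rho> * real q) ^ l \<le> G"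
    unfolding G_def using growth_ge_1 growth_mono Suc.prems by auto
  define x y where "x = (\<lambda>e. survival l (step e C) \<T>)" and "y = (\<lambda>e. survival l (step e C) {T})"
  define g where "g = (\<lambda>S. \<Sum>T'\<in>\<T>. influence l S T')"
  have g0: "0 \<le> g S" for S unfolding g_def by (intro sum_nonneg) (simp add: influence_nonneg)
  have sd: "(step e C - C) \<union> (C - step e C) \<subseteq> inc e" for e by (auto simp: step_def)
  have x: "\<bar>x e - survival l C \<T>\<bar> \<le> (\<Sum>S\<in>inc e. g S)" if "e \<in> A" for e
  proof -
    have "\<bar>x e - survival l C \<T>\<bar> \<le> (\<Sum>S\<in>(step e C - C) \<union> (C - step e C). g S)"
      unfolding x_def g_def using that fT Suc.prems step_subset by (intro survival_lipschitz) auto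
    also have "\<dots> \<le> (\<Sum>S\<in>inc e. g S)"
      using sd that g0 finite_inc by (intro sum_mono2) auto
    finally show ?thesis .
  qed
  have y: "\<bar>y e - survival l C {T}\<bar> \<le> (\<Sum>S\<in>inc e. influence l S T)" if "e \<in> A" for e
  proof -
    have "\<bar>y e - survival l C {T}\<bar> \<le> (\<Sum>S\<in>(step e C - C) \<union> (C - step e C). \<Sum>T\<in>{T}. influence l S T)"
      unfolding y_def using that fT Suc.prems step_subset by (intro survival_lipschitz) auto
    also have "\<dots> = (\<Sum>S\<in>(step e C - C) \<union> (C - step e C). influence l S T)" by simp
    also have "\<dots> \<le> (\<Sum>S\<in>inc e. influence l S T)"
      using sd that influence_nonneg finite_inc by (intro sum_mono2) auto
    finally show ?thesis .
  qed
  have sum_g: "(\<Sum>S\<in>W. g S) \<le> real (card \<T>) * G"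
  proof -
    have "(\<Sum>S\<in>W. g S) = (\<Sum>T'\<in>\<T>. \<Sum>S\<in>W. influence l S T')" unfolding g_def by (rule sum.swap)
    also have "\<dots> \<le> (\<Sum>T'\<in>\<T>. G)" using assms(1) Gl by (intro sum_mono) (auto simp: influence_sum)
    finally show ?thesis by simp
  qed
  have sum_T: "(\<Sum>S\<in>W. influence l S T) \<le> G" using assms(2) Gl by (simp add: influence_sum)
  define m where "m = real L * \<kappa> * G"
  have m: "influence l S T' \<le> m" if "S \<in> W" "T' \<in> W" "S \<noteq> T'" for S T'
  proof -
    have "influence l S T' \<le> real l * \<kappa> * (1 + \<rho> * q) ^ l" using that by (rule influence_off_diagonal)
    also have "\<dots> \<le> m" unfolding m_def using Suc.prems \<kappa>_nonneg Gl growth_ge_1[of l] G1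
      by (intro mult_mono mult_nonneg_nonneg) auto
    finally show ?thesis .
  qed
  have m0: "0 \<le> m" unfolding m_def using \<kappa>_nonneg G1 by simp
  have pair: "(\<Sum>S\<in>W. influence l S T' * influence l S T) \<le> 2 * m * G" if T': "T' \<in> \<T>" for T'
  proof -
    have "(\<Sum>S\<in>W. influence l S T' * influence l S T) \<le> (\<Sum>S\<in>W. m * influence l S T' + m * influence l S T)"
    proof (intro sum_mono)
      fix S assume S: "S \<in> W"
      \<comment> \<open>Since \<open>T' \<noteq> T\<close>, at least one of the two influences is
        off-diagonal and hence at most \<open>m\<close>.\<close>
      consider "S \<noteq> T'" | "S \<noteq> T" using T' assms(3) by blast
      thus "influence l S T' * influence l S T \<le> m * influence l S T' + m * influence l S T"
      proof cases
        case 1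
        hence "influence l S T' * influence l S T \<le> m * influence l S T"
          using m[of S T'] S T' assms(1) influence_nonneg by (intro mult_right_mono) auto
        thus ?thesis using m0 influence_nonneg[of l S T'] by (simp add: add_increasing)
      next
        case 2
        hence "influence l S T' * influence l S T \<le> influence l S T' * m"
          using m[of S T] S assms(2) influence_nonneg by (intro mult_left_mono) auto
        thus ?thesis using m0 influence_nonneg[of l S T] by (simp add: add_increasing2 mult.commute)
      qed
    qed
    also have "\<dots> = m * (\<Sum>S\<in>W. influence l S T') + m * (\<Sum>S\<in>W. influence l S T)"
      by (simp add: sum.distrib sum_distrib_left)
    also have "\<dots> \<le> m * G + m * G"
      using m0 Gl T' assms(1,2) by (intro add_mono mult_left_mono) (auto simp: influence_sum)
    finally show ?thesis by (simp add: algebra_simps)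
  qed
  have sum_gT: "(\<Sum>S\<in>W. g S * influence l S T) \<le> real (card \<T>) * (2 * m * G)"
  proof -
    have "(\<Sum>S\<in>W. g S * influence l S T) = (\<Sum>T'\<in>\<T>. \<Sum>S\<in>W. influence l S T' * influence l S T)"
      unfolding g_def by (simp add: sum_distrib_right sum.swap[of _ \<T>])
    also have "\<dots> \<le> (\<Sum>T'\<in>\<T>. 2 * m * G)" by (intro sum_mono pair)
    finally show ?thesis by simp
  qed
  let ?c = "real (card \<T>)"
  have "\<bar>avg (\<lambda>e. x e * y e) - avg x * avg y\<bar> \<le>
      avg (\<lambda>e. (\<Sum>S\<in>inc e. g S) * (\<Sum>S\<in>inc e. influence l S T)) +
      avg (\<lambda>e. \<Sum>S\<in>inc e. g S) * avg (\<lambda>e. \<Sum>S\<in>inc e. influence l S T)"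
    by (rule avg_covariance[OF x y])
  also have "\<dots> \<le> (\<rho> * (\<Sum>S\<in>W. g S * influence l S T) + \<kappa> * (\<Sum>S\<in>W. g S) * (\<Sum>S\<in>W. influence l S T)) +
      (\<rho> * (\<Sum>S\<in>W. g S)) * (\<rho> * (\<Sum>S\<in>W. influence l S T))"
    unfolding avg_inc_sum by (intro add_right_mono avg_inc_sum_prod) (auto simp: g0 influence_nonneg)
  also have "\<dots> \<le> (\<rho> * (?c * (2 * m * G)) + \<kappa> * (?c * G) * G) + (\<rho> * (?c * G)) * (\<rho> * G)"
    using \<rho>_nonneg \<kappa>_nonneg G1 sum_g sum_T sum_gT g0 influence_nonneg
    by (intro add_mono mult_mono mult_left_mono mult_nonneg_nonneg sum_nonneg) auto
  also have "\<dots> = ?c * cov_bound L"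
    unfolding cov_bound_def G_def[symmetric] m_def by (simp add: power2_eq_square algebra_simps)
  finally have cov: "\<bar>avg (\<lambda>e. x e * y e) - avg x * avg y\<bar> \<le> ?c * cov_bound L" .
  have "\<bar>avg (\<lambda>e. survival l (step e C) (insert T \<T>) - x e * y e)\<bar> \<le>
      avg (\<lambda>e. \<bar>survival l (step e C) (insert T \<T>) - x e * y e\<bar>)" by (rule avg_abs)
  also have "\<dots> \<le> avg (\<lambda>e. ?c * real l * cov_bound L)"
    unfolding x_def y_def using Suc.prems step_subset by (intro avg_mono Suc.IH) auto
  finally have "\<bar>avg (\<lambda>e. survival l (step e C) (insert T \<T>)) - avg (\<lambda>e. x e * y e)\<bar> \<le>
      ?c * real l * cov_bound L" by (simp add: avg_diff avg_const)
  with cov have "\<bar>avg (\<lambda>e. survival l (step e C) (insert T \<T>)) - avg x * avg y\<bar> \<le>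
      ?c * real l * cov_bound L + ?c * cov_bound L" by linarith
  thus ?case by (simp add: survival_Suc x_def y_def algebra_simps)
qed

lemma survival_empty: "survival l C {} = 1"
  by (induction l arbitrary: C) (simp_all add: survival_Suc avg_const, simp add: survival_def)

lemma cov_bound_nonneg: "0 \<le> cov_bound L"
  unfolding cov_bound_def using \<rho>_nonneg \<kappa>_nonneg by simp

lemma survival_almost_product:
  assumes "finite \<T>" "\<T> \<subseteq> W" "l \<le> L" "C \<subseteq> W"
  shows "\<bar>survival l C \<T> - (\<Prod>T\<in>\<T>. survival l C {T})\<bar> \<le> (real (card \<T>))\<^sup>2 * real l * cov_bound L"
  using assms(1,2)
proof (induction \<T>)
  case empty
  thus ?case by (simp add: survival_empty)
next
  case (insert T \<T>)
  let ?s = "survival l C" and ?c = "real (card \<T>)" and ?b = "real l * cov_bound L"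
  have "\<bar>?s (insert T \<T>) - ?s \<T> * ?s {T}\<bar> \<le> ?c * ?b"
    using insert assms survival_almost_independent[of \<T> T l L C] by (simp add: mult.assoc)
  moreover have "\<bar>?s \<T> * ?s {T} - (\<Prod>T\<in>\<T>. ?s {T}) * ?s {T}\<bar> \<le> ?c\<^sup>2 * ?b * 1"
    unfolding left_diff_distrib[symmetric] abs_mult
    using insert cov_bound_nonneg by (intro mult_mono) (auto simp: survival_in_unit_interval mult.assoc)
  ultimately have "\<bar>?s (insert T \<T>) - (\<Prod>T\<in>\<T>. ?s {T}) * ?s {T}\<bar> \<le> (?c\<^sup>2 + ?c) * ?b"
    by (simp add: distrib_right)
  \<comment> \<open>Splitting off one vertex adds an error \<open>?c * ?b\<close>, and
    \<open>?c\<^sup>2 + ?c \<le> (?c + 1)\<^sup>2\<close>.\<close>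
  also have "\<dots> \<le> (real (card (insert T \<T>)))\<^sup>2 * ?b"
    using insert.hyps cov_bound_nonneg by (intro mult_right_mono) (auto simp: power2_eq_square algebra_simps)
  finally show ?case using insert.hyps by (simp add: mult.commute mult.left_commute)
qed

section \<open>Comparison with the deterministic recursion\<close>

lemma avg_swap: "avg (\<lambda>e. avg (\<lambda>e'. f e e')) = avg (\<lambda>e'. avg (\<lambda>e. f e e'))"
  unfolding avg_def sum_divide_distrib by (rule sum.swap)

text \<open>\<open>run_mean\<close> conditions on the first draw, whereas the recursion in time
  needs the last one: \<open>T\<close> gets covered there if the edge contains \<open>T\<close> and
  is still completely uncovered. The induction exchanges the averages over the first and the last
  draw.\<close>

lemma survival_Suc_last:
  "survival (Suc l) C {T} = survival l C {T} - avg (\<lambda>e. of_bool (T \<in> inc e) * survival l C (inc e))"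
proof (induction l arbitrary: C)
  case 0
  have "survival (Suc 0) C {T} =
      avg (\<lambda>e. of_bool (C \<inter> {T} = {}) - of_bool (T \<in> inc e) * of_bool (C \<inter> inc e = {}))"
    unfolding survival_Suc by (intro avg_cong) (auto simp: survival_def step_def)
  thus ?case by (simp add: avg_diff avg_const survival_def)
next
  case (Suc l)
  have "survival (Suc (Suc l)) C {T} = avg (\<lambda>e. survival (Suc l) (step e C) {T})" by (rule survival_Suc)
  also have "\<dots> = survival (Suc l) C {T} -
      avg (\<lambda>e'. of_bool (T \<in> inc e') * avg (\<lambda>e. survival l (step e C) (inc e')))"
    unfolding Suc avg_diff survival_Suc[of l C, symmetric] by (subst avg_swap) (simp only: avg_cmult survival_Suc)
  finally show ?case unfolding survival_Suc[of l C, symmetric] .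
qed

lemma degree_le_1: "T \<in> W \<Longrightarrow> \<rho> \<le> 1"
  using avg_mono[of "\<lambda>e. of_bool (T \<in> inc e)" "\<lambda>_. 1"] by (simp add: avg_inc_of_bool avg_const)

text \<open>Euler steps for \<open>y' = - y ^ q\<close>.\<close>

fun fluid :: "nat \<Rightarrow> real" where
  "fluid 0 = 1"
| "fluid (Suc m) = fluid m - \<rho> * fluid m ^ q"

lemma fluid_in_unit_interval:
  assumes "\<rho> \<le> 1"
  shows "fluid m \<in> {0..1}"
proof (induction m)
  case (Suc m)
  have "\<rho> * fluid m ^ q \<le> 1 * fluid m"
    using Suc assms q_pos \<rho>_nonneg power_decreasing[of 1 q "fluid m"] by (intro mult_mono) auto
  moreover have "0 \<le> \<rho> * fluid m ^ q" using Suc \<rho>_nonneg by simp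
  ultimately show ?case using Suc by simp
qed simp

text \<open>Along \<open>y' = - \<rho> * y ^ q\<close> the quantity
  \<open>y powr (- (q - 1))\<close> grows at the constant rate \<open>(q - 1) * \<rho>\<close>. In
  the discrete form, one step multiplies \<open>fluid m\<close> by \<open>1 - x\<close>; Bernoulli's
  inequality turns \<open>1 + ?D * x\<close> into \<open>(1 + x) ^ ?D\<close>, and what remains is
  \<open>(1 - x\<^sup>2) ^ ?D\<close>.\<close>

lemma fluid_decay:
  assumes "\<rho> \<le> 1"
  shows "(1 + real (q - 1) * \<rho> * m) * fluid m ^ (q - 1) \<le> 1"
proof (induction m)
  case (Suc m)
  let ?D = "q - 1"
  define x where "x = \<rho> * fluid m ^ ?D"
  have y: "0 \<le> fluid m" "fluid m \<le> 1" using fluid_in_unit_interval[OF assms] by auto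
  have x: "0 \<le> x" "x \<le> 1" unfolding x_def
    using y \<rho>_nonneg assms mult_mono[of \<rho> 1 "fluid m ^ ?D" 1] by (auto simp: power_le_one)
  have "fluid m ^ q = fluid m * fluid m ^ ?D"
    using q_pos by (metis Suc_diff_1 less_le_trans power_Suc zero_less_one)
  hence y': "fluid (Suc m) = fluid m * (1 - x)" by (simp add: x_def algebra_simps)
  have "(1 + real ?D * \<rho> * Suc m) * fluid (Suc m) ^ ?D =
      ((1 + real ?D * \<rho> * m) * fluid m ^ ?D + ?D * x) * (1 - x) ^ ?D"
    unfolding y' power_mult_distrib by (simp add: x_def algebra_simps)
  also have "\<dots> \<le> (1 + ?D * x) * (1 - x) ^ ?D"
    using Suc x by (intro mult_right_mono add_right_mono) auto
  also have "\<dots> \<le> (1 + x) ^ ?D * (1 - x) ^ ?D"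
    using x Bernoulli_inequality[of x ?D] by (intro mult_right_mono) auto
  also have "\<dots> = (1 - x\<^sup>2) ^ ?D"
    unfolding power_mult_distrib[symmetric] by (simp add: power2_eq_square algebra_simps)
  also have "\<dots> \<le> 1" using x by (intro power_le_one) (auto simp: power_le_one)
  finally show ?case .
qed simp

lemma fluid_le:
  assumes "\<rho> \<le> 1" "2 \<le> q"
  shows "fluid m \<le> (1 + real (q - 1) * \<rho> * m) powr (- 1 / real (q - 1))"
proof (cases "fluid m = 0")
  case False
  let ?D = "q - 1" and ?c = "1 + real (q - 1) * \<rho> * m"
  have y: "0 < fluid m" using False fluid_in_unit_interval[OF assms(1), of m] by auto
  have c: "1 \<le> ?c" using \<rho>_nonneg by simp
  have "fluid m powr real ?D \<le> ?c powr (-1)"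
    using fluid_decay[OF assms(1), of m] y c by (simp add: powr_realpow powr_minus field_simps)
  hence "(fluid m powr real ?D) powr (1 / real ?D) \<le> (?c powr (-1)) powr (1 / real ?D)"
    using assms(2) by (intro powr_mono2) auto
  hence "fluid m powr (real ?D * (1 / real ?D)) \<le> ?c powr (- 1 * (1 / real ?D))"
    by (simp only: powr_powr)
  moreover have "real ?D * (1 / real ?D) = 1" "- 1 * (1 / real ?D) = - 1 / real ?D"
    using assms(2) by simp_all
  ultimately show ?thesis using y by (simp only: powr_one)
qed auto

text \<open>Discrete Gronwall argument: replacing joint survival by a product costs \<eta> per step,
  and an error \<delta> in each of the \<open>q\<close> factors returns as
  \<open>q * \<delta>\<close>, both weighted with \<rho>. Hence a factor
  \<open>1 + \<rho> * q\<close> for each step.\<close>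

lemma survival_near_fluid:
  assumes "m \<le> L" "T \<in> W"
  shows "\<bar>survival m {} {T} - fluid m\<bar> \<le>
    real m * (\<rho> * ((real q)\<^sup>2 * real L * cov_bound L)) * (1 + \<rho> * q) ^ m"
  using assms
proof (induction m arbitrary: T)
  case 0
  thus ?case by (simp add: survival_def)
next
  case (Suc m)
  define \<eta> where "\<eta> = (real q)\<^sup>2 * real L * cov_bound L"
  define G where "G = (1 + \<rho> * real q) ^ m"
  define \<delta> where "\<delta> = real m * (\<rho> * \<eta>) * G"
  have \<eta>0: "0 \<le> \<eta>" unfolding \<eta>_def using cov_bound_nonneg by simp
  have G1: "1 \<le> G" unfolding G_def by (rule growth_ge_1)
  have IH: "\<bar>survival m {} {T} - fluid m\<bar> \<le> \<delta>" if "T \<in> W" for T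
    using Suc that unfolding \<delta>_def \<eta>_def G_def by auto
  have fluid01: "0 \<le> fluid m" "fluid m \<le> 1"
    using fluid_in_unit_interval[OF degree_le_1[OF Suc.prems(2)], of m] by auto
  have edge: "\<bar>survival m {} (inc e) - fluid m ^ q\<bar> \<le> \<eta> + q * \<delta>" if e: "e \<in> A" for e
  proof -
    have "\<bar>survival m {} (inc e) - (\<Prod>S\<in>inc e. survival m {} {S})\<bar> \<le> (real q)\<^sup>2 * real m * cov_bound L"
      using survival_almost_product[of "inc e" m L "{}"] Suc.prems finite_inc[OF e] inc_subset[OF e] inc_card[OF e]
      by simp
    also have "\<dots> \<le> \<eta>" unfolding \<eta>_def using Suc.prems cov_bound_nonneg
      by (intro mult_right_mono mult_left_mono) auto
    finally have 1: "\<bar>survival m {} (inc e) - (\<Prod>S\<in>inc e. survival m {} {S})\<bar> \<le> \<eta>" .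
    \<comment> \<open>A product of numbers from the unit interval changes at most by the sum of the
      changes of its factors.\<close>
    have "norm ((\<Prod>S\<in>inc e. survival m {} {S}) - (\<Prod>S\<in>inc e. fluid m)) \<le>
        (\<Sum>S\<in>inc e. norm (survival m {} {S} - fluid m))"
      by (intro norm_prod_diff) (auto simp: survival_in_unit_interval fluid01)
    also have "\<dots> \<le> (\<Sum>S\<in>inc e. \<delta>)" using inc_subset[OF e] by (intro sum_mono) (auto intro: IH)
    finally have 2: "\<bar>(\<Prod>S\<in>inc e. survival m {} {S}) - fluid m ^ q\<bar> \<le> q * \<delta>"
      using inc_card[OF e] by simp
    from 1 2 show ?thesis by linarith
  qed
  have "survival (Suc m) {} {T} - fluid (Suc m) = (survival m {} {T} - fluid m) -
      avg (\<lambda>e. of_bool (T \<in> inc e) * (survival m {} (inc e) - fluid m ^ q))"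
  proof -
    have "avg (\<lambda>e. of_bool (T \<in> inc e) * (survival m {} (inc e) - fluid m ^ q)) =
        avg (\<lambda>e. of_bool (T \<in> inc e) * survival m {} (inc e)) - avg (\<lambda>e. fluid m ^ q * of_bool (T \<in> inc e))"
      unfolding avg_diff[symmetric] by (intro avg_cong) (simp add: algebra_simps)
    also have "avg (\<lambda>e. fluid m ^ q * of_bool (T \<in> inc e)) = fluid m ^ q * \<rho>"
      using Suc.prems by (simp only: avg_cmult avg_inc_of_bool)
    finally show ?thesis by (simp add: survival_Suc_last)
  qed
  also have "\<bar>\<dots>\<bar> \<le> \<delta> + \<rho> * (\<eta> + q * \<delta>)"
  proof -
    have "\<bar>avg (\<lambda>e. of_bool (T \<in> inc e) * (survival m {} (inc e) - fluid m ^ q))\<bar> \<le>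
        avg (\<lambda>e. (\<eta> + q * \<delta>) * of_bool (T \<in> inc e))"
      by (rule order.trans[OF avg_abs avg_mono]) (auto simp: edge)
    also have "\<dots> = \<rho> * (\<eta> + q * \<delta>)" using Suc.prems by (simp add: avg_cmult avg_inc_of_bool)
    finally show ?thesis using IH[OF Suc.prems(2)] by linarith
  qed
  also have "\<dots> = (1 + \<rho> * q) * \<delta> + \<rho> * \<eta>" by (simp add: algebra_simps)
  also have "\<dots> \<le> (1 + \<rho> * q) * \<delta> + (\<rho> * \<eta>) * ((1 + \<rho> * q) * G)"
  proof -
    have "1 \<le> (1 + \<rho> * q) * G" using growth_ge_1[of "Suc m"] by (simp add: G_def)
    hence "\<rho> * \<eta> * 1 \<le> \<rho> * \<eta> * ((1 + \<rho> * q) * G)" using \<eta>0 \<rho>_nonneg by (intro mult_left_mono) auto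
    thus ?thesis by simp
  qed
  also have "\<dots> = real (Suc m) * (\<rho> * \<eta>) * (1 + \<rho> * q) ^ Suc m"
    unfolding \<delta>_def G_def by (simp add: algebra_simps)
  finally show ?case unfolding \<eta>_def .
qed

section \<open>Random orderings and independent draws\<close>

definition perm_avg :: "('v set \<Rightarrow> real) \<Rightarrow> 'v set \<Rightarrow> real" where
  "perm_avg \<psi> C =
     (\<Sum>\<sigma>\<in>permutations_of_set A. \<psi> (fold step \<sigma> C)) / real (card (permutations_of_set A))"

lemma subset_fold_step: "C \<subseteq> fold step \<sigma> C"
proof (induction \<sigma> arbitrary: C)
  case (Cons e \<sigma>)
  have "C \<subseteq> step e C" by (auto simp: step_def)
  also have "\<dots> \<subseteq> fold step (e # \<sigma>) C" using Cons[of "step e C"] by simp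
  finally show ?case .
qed simp

text \<open>An edge that meets the covered set is rejected now and for ever, so its position in the
  ordering has no effect.\<close>

lemma fold_step_remove1:
  "inc e \<inter> C \<noteq> {} \<Longrightarrow> fold step (remove1 e \<sigma>) C = fold step \<sigma> C"
proof (induction \<sigma> arbitrary: C)
  case (Cons x \<sigma>)
  show ?case
  proof (cases "x = e")
    case True
    thus ?thesis using Cons.prems by (simp add: step_def)
  next
    case False
    have "inc e \<inter> step x C \<noteq> {}" using Cons.prems by (auto simp: step_def)
    thus ?thesis using False Cons.IH by simp
  qed
qed simp

text \<open>Moving a uniformly random edge to the front of a uniformly random ordering leaves the
  ordering uniformly random, so an ordering may be preceded by any number of independent
  uniformly random edges.\<close>

lemma perm_avg_step: "perm_avg \<psi> C = avg (\<lambda>e. perm_avg \<psi> (step e C))"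
proof -
  let ?P = permutations_of_set
  have "(\<Sum>\<sigma>\<in>?P A. \<psi> (fold step \<sigma> (step e C))) =
      real (card A) * (\<Sum>\<tau>\<in>?P (A - {e}). \<psi> (fold step (e # \<tau>) C))" if e: "e \<in> A" for e
  proof -
    have "inc e \<inter> step e C \<noteq> {}" using inc_card[OF e] q_pos by (auto simp: step_def)
    hence "(\<Sum>\<sigma>\<in>?P A. \<psi> (fold step \<sigma> (step e C))) =
        (\<Sum>\<sigma>\<in>?P A. \<psi> (fold step (remove1 e \<sigma>) (step e C)))"
      by (simp add: fold_step_remove1)
    also have "\<dots> = real (card A) * (\<Sum>\<tau>\<in>?P (A - {e}). \<psi> (fold step \<tau> (step e C)))"
      using finite_A e by (rule sum_permutations_of_set_remove1)
    finally show ?thesis by simp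
  qed
  hence "avg (\<lambda>e. perm_avg \<psi> (step e C)) =
      (\<Sum>e\<in>A. \<Sum>\<tau>\<in>?P (A - {e}). \<psi> (fold step (e # \<tau>) C)) / real (card (?P A))"
    using card_A_pos by (simp add: avg_def perm_avg_def sum_divide_distrib[symmetric] sum_distrib_left[symmetric])
  also have "\<dots> = perm_avg \<psi> C"
    using finite_A A_nonempty by (simp add: perm_avg_def sum_permutations_of_set_Cons)
  finally show ?thesis by simp
qed

text \<open>Put \<open>l\<close> independent draws in front of the ordering by
  \<open>perm_avg_step\<close>, then drop the ordering: what it does after these draws can only
  enlarge the covered set and so decrease \<psi>.\<close>

lemma perm_avg_le_run_mean:
  assumes "\<And>C C'. C \<subseteq> C' \<Longrightarrow> \<psi> C' \<le> \<psi> C"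
  shows "perm_avg \<psi> C \<le> run_mean l \<psi> C"
proof (induction l arbitrary: C)
  case 0
  have "(\<Sum>\<sigma>\<in>permutations_of_set A. \<psi> (fold step \<sigma> C)) \<le> (\<Sum>\<sigma>\<in>permutations_of_set A. \<psi> C)"
    by (intro sum_mono assms subset_fold_step)
  thus ?case using finite_A by (simp add: perm_avg_def divide_simps mult.commute card_gt_0_iff)
next
  case (Suc l)
  show ?case by (subst perm_avg_step) (auto intro!: avg_mono Suc)
qed

lemma perm_avg_uncovered_le:
  assumes "T \<in> W" "2 \<le> q"
  shows "perm_avg (\<lambda>C. of_bool (T \<notin> C)) {} \<le> (1 + real (q - 1) * \<rho> * L) powr (- 1 / real (q - 1)) +
    real L * (\<rho> * ((real q)\<^sup>2 * real L * cov_bound L)) * (1 + \<rho> * q) ^ L"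
proof -
  have "perm_avg (\<lambda>C. of_bool (T \<notin> C)) {} \<le> run_mean L (\<lambda>C. of_bool (T \<notin> C)) {}"
    by (rule perm_avg_le_run_mean) auto
  also have "\<dots> = survival L {} {T}" by (simp add: survival_def)
  finally show ?thesis
    using survival_near_fluid[of L L T] fluid_le[OF degree_le_1[OF assms(1)] assms(2), of L] assms by simp
qed

end

section \<open>Random greedy coverings\<close>

lemma card_supersets:
  assumes "finite V" "S \<subseteq> V" "card S \<le> m"
  shows "card {b \<in> nsets V m. S \<subseteq> b} = (card V - card S) choose (m - card S)"
proof -
  have fS: "finite S" using assms finite_subset by blast
  have "bij_betw (\<lambda>b. b \<union> S) (nsets (V - S) (m - card S)) {b \<in> nsets V m. S \<subseteq> b}"
  proof (rule bij_betw_byWitness[where f' = "\<lambda>b. b - S"])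
    show "(\<lambda>b. b \<union> S) ` nsets (V - S) (m - card S) \<subseteq> {b \<in> nsets V m. S \<subseteq> b}"
    proof safe
      fix b assume "b \<in> nsets (V - S) (m - card S)"
      hence b: "b \<subseteq> V - S" "finite b" "card b = m - card S" by (auto simp: nsets_def)
      hence "b \<inter> S = {}" by blast
      hence "card (b \<union> S) = m" using b assms fS by (simp add: card_Un_disjoint)
      thus "b \<union> S \<in> nsets V m" using b assms fS by (auto simp: nsets_def)
    qed
    show "(\<lambda>b. b - S) ` {b \<in> nsets V m. S \<subseteq> b} \<subseteq> nsets (V - S) (m - card S)"
      using fS by (auto simp: nsets_def card_Diff_subset)
    show "\<forall>b\<in>nsets (V - S) (m - card S). b \<union> S - S = b" by (auto simp: nsets_def)
    show "\<forall>b\<in>{b \<in> nsets V m. S \<subseteq> b}. b - S \<union> S = b" by auto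
  qed
  hence "card {b \<in> nsets V m. S \<subseteq> b} = card (nsets (V - S) (m - card S))"
    by (simp only: bij_betw_same_card)
  also have "\<dots> = card (V - S) choose (m - card S)" by (rule card_nsets)
  also have "card (V - S) = card V - card S" using assms fS by (simp add: card_Diff_subset)
  finally show ?thesis .
qed

text \<open>A crude bound that serves twice: it gives \<open>2 \<le> k choose t\<close>, and it
  shows that the number of \<open>t\<close>-sets grows at least linearly in
  \<open>n\<close>.\<close>

lemma binomial_gt_diff: "1 \<le> t \<Longrightarrow> t \<le> n \<Longrightarrow> n - t < n choose t"
proof (induction n)
  case (Suc n)
  show ?case
  proof (cases "t = Suc n")
    case False
    hence tn: "t \<le> n" using Suc.prems by simp
    obtain s where s: "t = Suc s" using Suc.prems by (cases t) auto
    have "1 \<le> n choose s" using s tn by (simp add: Suc_leI zero_less_binomial_iff)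
    moreover have "n - t < n choose t" using Suc tn by simp
    moreover have "Suc n choose t = (n choose s) + (n choose t)" by (simp add: s)
    ultimately show ?thesis using tn by linarith
  qed simp
qed simp

text \<open>The degree follows from counting pairs of a \<open>k\<close>-set and a
  \<open>t\<close>-subset of it. Two different \<open>t\<close>-sets together have at least
  \<open>t + 1\<close> points, so a \<open>k\<close>-set containing both contains
  \<open>insert x S\<close>; passing from \<open>t\<close> to \<open>t + 1\<close> prescribed points
  costs the factor \<open>(k - t) / (n - t)\<close>.\<close>

lemma nsets_regular_hypergraph:
  fixes V :: "'a set"
  assumes "finite V" "card V = n" "t < k" "k \<le> n"
  shows "regular_hypergraph (nsets V t) (nsets V k) (\<lambda>b. nsets b t) (k choose t)
    (real (k choose t) / real (n choose t))
    (real (k choose t) / real (n choose t) * (real (k - t) / real (n - t)))"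
proof
  let ?\<rho> = "real (k choose t) / real (n choose t)"
  have Npos: "0 < n choose k" using assms by (simp add: zero_less_binomial_iff)
  have Mpos: "0 < n choose t" using assms by (simp add: zero_less_binomial_iff)
  have cA: "card (nsets V k) = n choose k" using assms(2) by (simp add: card_nsets)
  have dN: "real ((n - t) choose (k - t)) = ?\<rho> * real (n choose k)"
  proof -
    have "(n choose k) * (k choose t) = (n choose t) * ((n - t) choose (k - t))"
      using assms by (intro choose_mult) auto
    hence "real (n choose k) * real (k choose t) = real (n choose t) * real ((n - t) choose (k - t))"
      by (metis of_nat_mult)
    thus ?thesis using Mpos by (simp add: field_simps)
  qed
  show "finite (nsets V t)" "finite (nsets V k)" using assms by (auto intro: finite_imp_finite_nsets)
  show "nsets V k \<noteq> {}" using cA Npos by (metis card.empty less_irrefl)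
  show "nsets b t \<subseteq> nsets V t" if "b \<in> nsets V k" for b
    using that by (auto simp: nsets_def)
  show "card (nsets b t) = k choose t" if "b \<in> nsets V k" for b
    using that by (simp add: card_nsets) (simp add: nsets_def)
  show "1 \<le> k choose t" using assms by (simp add: Suc_leI zero_less_binomial_iff)
  show "real (card {b \<in> nsets V k. S \<in> nsets b t}) = ?\<rho> * real (card (nsets V k))"
    if S: "S \<in> nsets V t" for S
  proof -
    have "{b \<in> nsets V k. S \<in> nsets b t} = {b \<in> nsets V k. S \<subseteq> b}"
      using S by (auto simp: nsets_def)
    moreover have "card {b \<in> nsets V k. S \<subseteq> b} = (n - t) choose (k - t)"
      using S assms card_supersets[of V S k] by (auto simp: nsets_def)
    ultimately show ?thesis using dN cA by simp
  qed
  show "real (card {b \<in> nsets V k. S \<in> nsets b t \<and> S' \<in> nsets b t}) \<le>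
      ?\<rho> * (real (k - t) / real (n - t)) * real (card (nsets V k))"
    if S: "S \<in> nsets V t" and S': "S' \<in> nsets V t" and ne: "S \<noteq> S'" for S S'
  proof -
    have "\<not> S' \<subseteq> S" using S S' ne card_subset_eq[of S S'] by (auto simp: nsets_def)
    then obtain x where x: "x \<in> S'" "x \<notin> S" by blast
    have xV: "insert x S \<subseteq> V" "card (insert x S) = Suc t" using S S' x by (auto simp: nsets_def)
    have "card {b \<in> nsets V k. S \<in> nsets b t \<and> S' \<in> nsets b t} \<le> card {b \<in> nsets V k. insert x S \<subseteq> b}"
      using assms x by (intro card_mono finite_subset[OF _ finite_imp_finite_nsets[of V k]]) (auto simp: nsets_def)
    also have "\<dots> = (n - Suc t) choose (k - Suc t)"
      using xV assms card_supersets[of V "insert x S" k] by auto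
    finally have "real (card {b \<in> nsets V k. S \<in> nsets b t \<and> S' \<in> nsets b t}) \<le>
      real ((n - Suc t) choose (k - Suc t))" by linarith
    also have "\<dots> = real ((n - t) choose (k - t)) * (real (k - t) / real (n - t))"
    proof -
      have "(k - t) * ((n - t) choose (k - t)) = (n - t) * ((n - Suc t) choose (k - Suc t))"
        using Suc_times_binomial[of "k - Suc t" "n - Suc t"] assms by (simp add: Suc_diff_Suc)
      hence "real (k - t) * real ((n - t) choose (k - t)) = real (n - t) * real ((n - Suc t) choose (k - Suc t))"
        by (metis of_nat_mult)
      thus ?thesis using assms by (simp add: field_simps)
    qed
    finally show ?thesis unfolding dN cA by (simp add: mult_ac)
  qed
qed auto

section \<open>Greedy choice as a single pass through the ordering\<close>

definition greedy_blocks :: "nat \<Rightarrow> 'a set list \<Rightarrow> 'a set set \<Rightarrow> 'a set set" where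
  "greedy_blocks t = fold (\<lambda>b B. if choosable t B b then insert b B else B)"

lemma greedy_blocks_simps [simp]:
  "greedy_blocks t [] B = B"
  "greedy_blocks t (b # \<sigma>) B = greedy_blocks t \<sigma> (if choosable t B b then insert b B else B)"
  "greedy_blocks t (\<sigma> @ \<tau>) B = greedy_blocks t \<tau> (greedy_blocks t \<sigma> B)"
  by (simp_all add: greedy_blocks_def)

lemma subset_greedy_blocks: "B \<subseteq> greedy_blocks t \<sigma> B"
proof (induction \<sigma> arbitrary: B)
  case (Cons b \<sigma>)
  have "B \<subseteq> (if choosable t B b then insert b B else B)" by auto
  also have "\<dots> \<subseteq> greedy_blocks t (b # \<sigma>) B" by (simp only: greedy_blocks_simps Cons.IH)
  finally show ?case .
qed simp

lemma choosable_antimono: "B \<subseteq> B' \<Longrightarrow> choosable t B' b \<Longrightarrow> choosable t B b"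
  by (auto simp: choosable_def covered_def)

lemma not_choosable_member: "nsets b t \<noteq> {} \<Longrightarrow> b \<in> B \<Longrightarrow> \<not> choosable t B b"
  by (auto simp: choosable_def covered_def nsets_def)

text \<open>A set that has been passed was either rejected, and stays blocked as more gets covered,
  or was chosen, and now blocks itself. The latter requires that it has a \<open>t\<close>-subset at
  all.\<close>

lemma not_choosable_greedy_blocks:
  assumes "b \<in> set \<sigma>" "nsets b t \<noteq> {}"
  shows "\<not> choosable t (greedy_blocks t \<sigma> B) b"
  using assms(1)
proof (induction \<sigma> arbitrary: B)
  case (Cons x \<sigma>)
  show ?case
  proof (cases "b = x")
    case True
    let ?B = "if choosable t B x then insert x B else B"
    have "\<not> choosable t ?B b" using True assms(2) not_choosable_member[of b t "insert b B"] by auto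
    moreover have "?B \<subseteq> greedy_blocks t (x # \<sigma>) B" using subset_greedy_blocks[of ?B t \<sigma>] by simp
    ultimately show ?thesis using choosable_antimono by blast
  qed (use Cons in auto)
qed simp

lemma greedy_blocks_none: "\<forall>b\<in>set \<sigma>. \<not> choosable t B b \<Longrightarrow> greedy_blocks t \<sigma> B = B"
  by (induction \<sigma>) auto

lemma find_append_right: "find P xs = None \<Longrightarrow> find P (xs @ ys) = find P ys"
  by (induction xs) (auto split: if_splits)

text \<open>The algorithm searches from the front each time, but everything in the prefix already
  scanned is blocked, so the search effectively resumes where it stopped.\<close>

lemma greedy_chosen_prefix:
  assumes "greedy_chosen t \<sigma> B" "\<forall>b\<in>set \<sigma>. nsets b t \<noteq> {}"
  shows "\<exists>\<sigma>1 \<sigma>2. \<sigma> = \<sigma>1 @ \<sigma>2 \<and> B = greedy_blocks t \<sigma>1 {}"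
  using assms(1)
proof induction
  case start
  show ?case by (rule exI[of _ "[]"]) simp
next
  case (choose B b)
  then obtain \<sigma>1 \<sigma>2 where \<sigma>: "\<sigma> = \<sigma>1 @ \<sigma>2" and B: "B = greedy_blocks t \<sigma>1 {}" by blast
  have "find (choosable t B) \<sigma>1 = None"
    unfolding find_None_iff B using not_choosable_greedy_blocks assms(2) \<sigma> by fastforce
  hence "find (choosable t B) \<sigma>2 = Some b" using choose.hyps(2) \<sigma> by (simp add: find_append_right)
  then obtain i where i: "i < length \<sigma>2" "choosable t B (\<sigma>2 ! i)" "b = \<sigma>2 ! i"
    "\<forall>j<i. \<not> choosable t B (\<sigma>2 ! j)" by (auto simp: find_Some_iff)
  have "\<forall>c\<in>set (take i \<sigma>2). \<not> choosable t B c" using i(1,4) by (auto simp: in_set_conv_nth)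
  hence "greedy_blocks t (\<sigma>1 @ take i \<sigma>2 @ [b]) {} = insert b B"
    using greedy_blocks_none[of "take i \<sigma>2" t B] i by (simp add: B[symmetric])
  moreover have "\<sigma> = (\<sigma>1 @ take i \<sigma>2 @ [b]) @ drop (Suc i) \<sigma>2"
    using \<sigma> i id_take_nth_drop[OF i(1)] by simp
  ultimately show ?case by metis
qed

text \<open>The unscanned rest contains nothing choosable, so scanning it changes nothing. Thus the
  chosen sets are a function of the ordering; only the completion leaves freedom.\<close>

lemma greedy_finished_unique:
  assumes "greedy_finished t \<sigma> B" "\<forall>b\<in>set \<sigma>. nsets b t \<noteq> {}"
  shows "B = greedy_blocks t \<sigma> {}"
proof -
  obtain \<sigma>1 \<sigma>2 where \<sigma>: "\<sigma> = \<sigma>1 @ \<sigma>2" and B: "B = greedy_blocks t \<sigma>1 {}"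
    using greedy_chosen_prefix assms by (metis greedy_finished_def)
  have "\<forall>b\<in>set \<sigma>2. \<not> choosable t B b"
    using assms(1) \<sigma> by (auto simp: greedy_finished_def find_None_iff)
  thus ?thesis using \<sigma> B greedy_blocks_none[of \<sigma>2 t B] by simp
qed

section \<open>Sizes of greedy coverings\<close>

lemma greedy_chosen_subset: "greedy_chosen t \<sigma> B \<Longrightarrow> B \<subseteq> set \<sigma>"
  by (induction rule: greedy_chosen.induct) (auto simp: find_Some_iff)

lemma greedy_chosen_disjoint:
  "greedy_chosen t \<sigma> B \<Longrightarrow> disjoint_family_on (\<lambda>b. nsets b t) B"
proof (induction rule: greedy_chosen.induct)
  case (choose B b)
  have c: "choosable t B b" using choose.hyps(2) by (auto simp: find_Some_iff)
  have "nsets b t \<inter> nsets b' t = {}" if "b' \<in> B" for b'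
    using c that by (auto simp: choosable_def covered_def nsets_def)
  thus ?case using choose.IH unfolding disjoint_family_on_def by (auto simp: Int_commute)
qed (simp add: disjoint_family_on_def)

lemma Union_nsets_covered: "(\<Union>b\<in>B. nsets b t) = {T. covered B T \<and> finite T \<and> card T = t}"
  by (auto simp: covered_def nsets_def)

definition num_uncovered :: "'a set \<Rightarrow> nat \<Rightarrow> 'a set list \<Rightarrow> nat" where
  "num_uncovered X t \<sigma> = card {T \<in> nsets X t. \<not> covered (greedy_blocks t \<sigma> {}) T}"

lemma nsets_nonempty: "b \<in> nsets X k \<Longrightarrow> t \<le> k \<Longrightarrow> nsets b t \<noteq> {}"
proof -
  assume "b \<in> nsets X k" "t \<le> k"
  hence "finite b" "card b = k" by (auto simp: nsets_def)
  then obtain T where "T \<subseteq> b" "card T = t" "finite T"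
    using \<open>t \<le> k\<close> by (metis obtain_subset_with_card_n)
  thus ?thesis by (auto simp: nsets_def)
qed

lemma greedy_covering_is_covering:
  assumes "greedy_covering n k t \<sigma> \<B>" "\<sigma> \<in> permutations_of_set (nsets {..<n} k)"
  shows "is_covering {..<n} n k t \<B>"
proof -
  let ?U = "\<lambda>B. {T \<in> nsets {..<n} t. \<not> covered B T}"
  obtain B g where B: "greedy_finished t \<sigma> B"
    and g: "\<forall>T\<in>?U B. g T \<in> nsets {..<n} k \<and> T \<subseteq> g T"
    and \<B>: "\<B> = mset_set B + image_mset g (mset_set (?U B))"
    using assms(1) unfolding greedy_covering_def Let_def by blast
  have BA: "B \<subseteq> nsets {..<n} k"
    using greedy_chosen_subset[of t \<sigma> B] B assms(2) by (auto simp: greedy_finished_def permutations_of_set_def)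
  have fin: "finite B" "finite (?U B)"
    using BA finite_imp_finite_nsets[of "{..<n}"] finite_subset by auto
  show ?thesis unfolding is_covering_def
  proof (intro conjI ballI)
    show "set_mset \<B> \<subseteq> nsets {..<n} k" using BA g fin by (auto simp: \<B>)
    fix T assume T: "T \<in> nsets {..<n} t"
    show "\<exists>b\<in>#\<B>. T \<subseteq> b"
    proof (cases "covered B T")
      case True
      thus ?thesis using fin by (auto simp: covered_def \<B>)
    next
      case False
      thus ?thesis using g T fin by (auto simp: \<B> intro!: bexI[of _ "g T"])
    qed
  qed auto
qed

text \<open>The chosen sets have disjoint families of \<open>k choose t\<close> subsets each, and
  together with the uncovered \<open>t\<close>-sets these exhaust all \<open>t\<close>-sets. The
  completion has one block per uncovered \<open>t\<close>-set, counted with multiplicity, so the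
  size does not depend on \<open>g\<close>.\<close>

lemma greedy_covering_size:
  assumes "greedy_covering n k t \<sigma> \<B>" "\<sigma> \<in> permutations_of_set (nsets {..<n} k)" "t \<le> k"
  shows "real (k choose t) * real (size \<B>) =
    real (n choose t) + (real (k choose t) - 1) * real (num_uncovered {..<n} t \<sigma>)"
proof -
  let ?U = "\<lambda>B. {T \<in> nsets {..<n} t. \<not> covered B T}"
  obtain B g where B: "greedy_finished t \<sigma> B"
    and \<B>: "\<B> = mset_set B + image_mset g (mset_set (?U B))"
    using assms(1) unfolding greedy_covering_def Let_def by blast
  have set\<sigma>: "set \<sigma> = nsets {..<n} k" using assms(2) by (simp add: permutations_of_set_def)
  have Beq: "B = greedy_blocks t \<sigma> {}"
    using greedy_finished_unique[OF B] nsets_nonempty assms(3) set\<sigma> by blast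
  have BA: "B \<subseteq> nsets {..<n} k"
    using greedy_chosen_subset[of t \<sigma> B] B set\<sigma> by (auto simp: greedy_finished_def)
  have fin: "finite B" "finite (?U B)"
    using BA finite_imp_finite_nsets[of "{..<n}"] finite_subset by auto
  have "card (\<Union>b\<in>B. nsets b t) = (\<Sum>b\<in>B. card (nsets b t))"
    using fin(1) BA greedy_chosen_disjoint B
    by (intro card_UN_disjoint') (auto simp: greedy_finished_def intro!: finite_imp_finite_nsets, auto simp: nsets_def)
  also have "\<dots> = (\<Sum>b\<in>B. k choose t)" using BA by (intro sum.cong refl) (auto simp: card_nsets, auto simp: nsets_def)
  finally have 1: "card (\<Union>b\<in>B. nsets b t) = card B * (k choose t)" by simp
  have "nsets {..<n} t = (\<Union>b\<in>B. nsets b t) \<union> ?U B"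
    using BA unfolding Union_nsets_covered by (auto simp: covered_def nsets_def)
  moreover have "(\<Union>b\<in>B. nsets b t) \<inter> ?U B = {}" unfolding Union_nsets_covered by auto
  moreover have "finite (nsets {..<n} t)" by (simp add: finite_imp_finite_nsets)
  ultimately have "card (nsets {..<n} t) = card (\<Union>b\<in>B. nsets b t) + card (?U B)"
    by (metis card_Un_disjoint finite_Un)
  hence "real (n choose t) = real (card B * (k choose t) + card (?U B))"
    using 1 by (simp add: card_nsets)
  moreover have "size \<B> = card B + card (?U B)" using fin by (simp add: \<B>)
  ultimately show ?thesis by (simp add: num_uncovered_def Beq[symmetric] algebra_simps)
qed

text \<open>Scanning a \<open>k\<close>-set is one \<open>step\<close> on the set of covered
  \<open>t\<close>-sets, and linearity of expectation reduces the count to single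
  \<open>t\<close>-sets. Of the three growth factors, two come from \<open>cov_bound\<close> and one
  from the Gronwall argument. \<open>L\<close> is still free.\<close>

lemma sum_num_uncovered_le:
  assumes "1 \<le> t" "t < k" "k \<le> n"
  defines "\<rho> \<equiv> real (k choose t) / real (n choose t)" and "q \<equiv> k choose t"
  shows "(\<Sum>\<sigma>\<in>permutations_of_set (nsets {..<n} k). real (num_uncovered {..<n} t \<sigma>)) /
      real (card (permutations_of_set (nsets {..<n} k))) \<le>
    real (n choose t) * ((1 + real (q - 1) * (\<rho> * real L)) powr (- 1 / real (q - 1)) +
      (real q)\<^sup>2 * (\<rho> * real L)\<^sup>2 * ((1 + \<rho> * q) ^ L) ^ 3 *
        (real (k - t) / real (n - t) * (2 * (\<rho> * real L) + 1) + \<rho>))"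
proof -
  let ?W = "nsets {..<n} t" and ?A = "nsets {..<n} k"
  interpret regular_hypergraph ?W ?A "\<lambda>b. nsets b t" q \<rho> "\<rho> * (real (k - t) / real (n - t))"
    unfolding q_def \<rho>_def using assms by (intro nsets_regular_hypergraph) auto
  have step: "fold step \<sigma> (\<Union>b\<in>B. nsets b t) = (\<Union>b\<in>greedy_blocks t \<sigma> B. nsets b t)" for \<sigma> B
  proof (induction \<sigma> arbitrary: B)
    case (Cons b \<sigma>)
    have "choosable t B b \<longleftrightarrow> nsets b t \<inter> (\<Union>b\<in>B. nsets b t) = {}"
      unfolding Union_nsets_covered choosable_def by (auto simp: nsets_def)
    hence "step b (\<Union>b\<in>B. nsets b t) = (\<Union>b\<in>(if choosable t B b then insert b B else B). nsets b t)"
      by (auto simp: step_def)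
    thus ?case using Cons by simp
  qed simp
  have q2: "2 \<le> q"
  proof -
    have "k - t < q" unfolding q_def using assms by (intro binomial_gt_diff) auto
    thus ?thesis using assms by simp
  qed
  let ?P = "permutations_of_set ?A"
  have "real (num_uncovered {..<n} t \<sigma>) = (\<Sum>T\<in>?W. of_bool (T \<notin> fold step \<sigma> {}))" for \<sigma>
  proof -
    have "{T \<in> ?W. \<not> covered (greedy_blocks t \<sigma> {}) T} = {T \<in> ?W. T \<notin> fold step \<sigma> {}}"
    proof -
      have "fold step \<sigma> {} = {T. covered (greedy_blocks t \<sigma> {}) T \<and> finite T \<and> card T = t}"
        using step[of \<sigma> "{}"] unfolding Union_nsets_covered[symmetric] by simp
      thus ?thesis by (auto simp: nsets_def)
    qed
    hence "real (num_uncovered {..<n} t \<sigma>) = (\<Sum>T\<in>{T \<in> ?W. T \<notin> fold step \<sigma> {}}. 1)"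
      by (simp add: num_uncovered_def)
    also have "\<dots> = (\<Sum>T\<in>?W. of_bool (T \<notin> fold step \<sigma> {}))"
      using finite_W by (intro sum.mono_neutral_cong_left) auto
    finally show ?thesis .
  qed
  hence "(\<Sum>\<sigma>\<in>?P. real (num_uncovered {..<n} t \<sigma>)) / real (card ?P) =
      (\<Sum>T\<in>?W. perm_avg (\<lambda>C. of_bool (T \<notin> C)) {})"
    by (simp only: perm_avg_def sum_divide_distrib) (rule sum.swap)
  also have "\<dots> \<le> (\<Sum>T\<in>?W. (1 + real (q - 1) * \<rho> * L) powr (- 1 / real (q - 1)) +
    real L * (\<rho> * ((real q)\<^sup>2 * real L * cov_bound L)) * (1 + \<rho> * q) ^ L)"
    using q2 by (intro sum_mono perm_avg_uncovered_le)
  also have "\<dots> = real (n choose t) * ((1 + real (q - 1) * \<rho> * L) powr (- 1 / real (q - 1)) +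
    real L * (\<rho> * ((real q)\<^sup>2 * real L * cov_bound L)) * (1 + \<rho> * q) ^ L)"
    by (simp add: card_nsets)
  also have "real L * (\<rho> * ((real q)\<^sup>2 * real L * cov_bound L)) * (1 + \<rho> * q) ^ L =
      (real q)\<^sup>2 * (\<rho> * real L)\<^sup>2 * ((1 + \<rho> * q) ^ L) ^ 3 *
        (real (k - t) / real (n - t) * (2 * (\<rho> * real L) + 1) + \<rho>)"
    unfolding cov_bound_def by (simp add: power2_eq_square power3_eq_cube algebra_simps add_divide_distrib)
  finally show ?thesis by (simp add: mult.assoc)
qed

section \<open>Choice of the number of draws\<close>

lemma greedy_uncovered_asymptotics:
  fixes t k :: nat
  assumes "1 \<le> t" "t < k"
  defines "D \<equiv> real (k choose t) - 1"
  shows "\<exists>K\<ge>0. \<forall>\<^sub>F n in sequentially.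
    (\<Sum>\<sigma>\<in>permutations_of_set (nsets {..<n} k). real (num_uncovered {..<n} t \<sigma>)) /
      real (card (permutations_of_set (nsets {..<n} k))) \<le>
    K * ln (real n) powr (- 1 / D) * real (n choose t)"
proof -
  define q where "q = k choose t"
  have "k - t < q" unfolding q_def using assms by (intro binomial_gt_diff) auto
  hence q2: "2 \<le> q" using assms by simp
  have D: "D = real (q - 1)" "1 \<le> D" using q2 by (auto simp: D_def q_def)
  \<comment> \<open>With \<open>L\<close> about \<open>a * M * ln n\<close> draws,
    \<open>\<rho> * L\<close> is about \<open>q * a * ln n\<close>. The growth factor is then at
    most \<open>n powr (q\<^sup>2 * a) = n powr (1/8)\<close>, and its cube
    \<open>n powr (3/8)\<close> is beaten by the codegree ratio of order
    \<open>1 / n\<close>.\<close>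
  define a :: real where "a = 1 / (8 * (real q)\<^sup>2)"
  have a0: "0 < a" using q2 by (simp add: a_def)
  have qa: "real q * a \<le> 1" "real q * (real q * a) = 1 / 8"
    using q2 by (auto simp: a_def power2_eq_square field_simps)
  define K where "K = (D * (real q * a)) powr (- 1 / D) + 1"
  define E where "E = (\<lambda>n. (real q)\<^sup>2 * (ln (real n))\<^sup>2 * real n powr (3/8) *
      (real k / (real n - real t) * (2 * ln (real n) + 1) + real q / (real n - real t)))"
  \<comment> \<open>The error has to be below \<open>1 / ln n\<close>; this is at most the target
    \<open>ln n powr (- 1 / D)\<close> because \<open>D \<ge> 1\<close>.\<close>
  have "((\<lambda>n. E n * ln (real n)) \<longlongrightarrow> 0) sequentially"
    unfolding E_def by real_asymp
  hence ev: "\<forall>\<^sub>F n in sequentially. E n * ln (real n) < 1"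
    by (rule order_tendstoD) simp
  have "\<forall>\<^sub>F n in sequentially. n \<ge> max (max k 3) (t + nat \<lceil>D * q\<rceil>)"
    by (rule eventually_ge_at_top)
  with ev have "\<forall>\<^sub>F n in sequentially.
    (\<Sum>\<sigma>\<in>permutations_of_set (nsets {..<n} k). real (num_uncovered {..<n} t \<sigma>)) /
      real (card (permutations_of_set (nsets {..<n} k))) \<le>
    K * ln (real n) powr (- 1 / D) * real (n choose t)"
  proof eventually_elim
    case (elim n)
    hence n: "k \<le> n" "3 \<le> n" "t + nat \<lceil>D * q\<rceil> \<le> n" by auto
    define M where "M = real (n choose t)"
    define \<rho> where "\<rho> = real q / M"
    define L where "L = nat \<lfloor>a * M * ln (real n)\<rfloor>"
    define z where "z = \<rho> * real L"
    have nt: "0 < real n - real t" using n assms by simp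
    have Mn: "real n - real t \<le> M"
      unfolding M_def using binomial_gt_diff[of t n] n assms by linarith
    have M0: "0 < M" using Mn nt by linarith
    have DM: "D * q \<le> M" using n(3) Mn by linarith
    have "exp 1 \<le> real n" using exp_le n(2) by linarith
    hence ln1: "1 \<le> ln (real n)" using n(2) by (subst ln_ge_iff) auto
    have L: "real L \<le> a * M * ln (real n)" "a * M * ln (real n) - 1 \<le> real L"
      unfolding L_def using a0 M0 ln1 by auto
    have \<rho>0: "0 \<le> \<rho>" using M0 by (simp add: \<rho>_def)
    have z0: "0 \<le> z" using \<rho>0 by (simp add: z_def)
    have "\<rho> * real L \<le> \<rho> * (a * M * ln (real n))" using L \<rho>0 by (intro mult_left_mono) auto
    also have "\<dots> = (real q * a) * ln (real n)" using M0 by (simp add: \<rho>_def)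
    finally have z1: "z \<le> (real q * a) * ln (real n)" by (simp add: z_def)
    also have "\<dots> \<le> 1 * ln (real n)" using qa(1) ln1 by (intro mult_right_mono) auto
    finally have z2: "z \<le> ln (real n)" by simp
    have "\<rho> * (a * M * ln (real n) - 1) \<le> z" unfolding z_def using L \<rho>0 by (intro mult_left_mono) auto
    moreover have "\<rho> * (a * M * ln (real n) - 1) = (real q * a) * ln (real n) - real q / M"
      using M0 by (simp add: \<rho>_def field_simps)
    ultimately have "D * ((real q * a) * ln (real n) - real q / M) \<le> D * z"
      using D by (intro mult_left_mono) auto
    \<comment> \<open>Rounding \<open>L\<close> down lowers \<open>z\<close> by at most
      \<open>\<rho> = q / M\<close>. Since \<open>n \<ge> t + D * q\<close>, this changes
      \<open>D * z\<close> by at most 1, which the summand 1 in \<open>1 + D * z\<close>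
      absorbs.\<close>
    moreover have "D * (real q / M) \<le> 1" using DM M0 by (simp add: field_simps)
    ultimately have z3: "D * (real q * a) * ln (real n) \<le> 1 + D * z"
      by (simp add: algebra_simps)
    have "(1 + D * z) powr (- 1 / D) \<le> (D * (real q * a) * ln (real n)) powr (- 1 / D)"
      using z3 D a0 ln1 q2 by (intro powr_mono2') auto
    also have "\<dots> = (D * (real q * a)) powr (- 1 / D) * ln (real n) powr (- 1 / D)"
      using D a0 ln1 by (simp add: powr_mult)
    finally have main: "(1 + D * z) powr (- 1 / D) \<le>
      (D * (real q * a)) powr (- 1 / D) * ln (real n) powr (- 1 / D)" .
    have "(1 + \<rho> * q) ^ L \<le> exp (\<rho> * q) ^ L"
      using \<rho>0 exp_ge_add_one_self[of "\<rho> * q"] by (intro power_mono) auto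
    also have "\<dots> = exp (real q * z)"
      unfolding z_def exp_of_nat_mult[symmetric] by (simp add: mult_ac)
    also have "\<dots> \<le> exp (real q * ((real q * a) * ln (real n)))"
      using z1 by (simp add: mult_left_mono)
    also have "real q * ((real q * a) * ln (real n)) = 1 / 8 * ln (real n)"
      using qa(2) by (metis mult.assoc)
    also have "exp (1 / 8 * ln (real n)) = real n powr (1 / 8)"
      using n by (simp add: powr_def)
    finally have "((1 + \<rho> * q) ^ L) ^ 3 \<le> (real n powr (1 / 8)) ^ 3"
      using \<rho>0 by (intro power_mono) auto
    also have "\<dots> = real n powr (3 / 8)"
      using n by (simp add: powr_powr flip: powr_realpow)
    finally have G: "((1 + \<rho> * q) ^ L) ^ 3 \<le> real n powr (3 / 8)" .
    have "real (k - t) / real (n - t) * (2 * z + 1) + \<rho> \<le>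
        real k / (real n - real t) * (2 * ln (real n) + 1) + real q / (real n - real t)"
    proof (intro add_mono mult_mono)
      show "real (k - t) / real (n - t) \<le> real k / (real n - real t)"
        using n assms by (simp add: of_nat_diff divide_right_mono)
      show "\<rho> \<le> real q / (real n - real t)" unfolding \<rho>_def using Mn nt M0
        by (intro divide_left_mono) auto
    qed (use nt z0 z2 in auto)
    hence "(real q)\<^sup>2 * z\<^sup>2 * ((1 + \<rho> * q) ^ L) ^ 3 *
        (real (k - t) / real (n - t) * (2 * z + 1) + \<rho>) \<le> E n"
      unfolding E_def using G z0 z2 ln1 \<rho>0
      by (intro mult_mono power_mono mult_nonneg_nonneg) auto
    also have "E n \<le> 1 / ln (real n)" using elim(1) ln1 by (simp add: field_simps)
    also have "\<dots> = ln (real n) powr (- 1)" using ln1 by (simp add: powr_minus_divide)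
    also have "\<dots> \<le> ln (real n) powr (- 1 / D)"
      using D ln1 by (intro powr_mono) (auto simp: field_simps)
    finally have err: "(real q)\<^sup>2 * z\<^sup>2 * ((1 + \<rho> * q) ^ L) ^ 3 *
        (real (k - t) / real (n - t) * (2 * z + 1) + \<rho>) \<le> ln (real n) powr (- 1 / D)" .
    have "(\<Sum>\<sigma>\<in>permutations_of_set (nsets {..<n} k). real (num_uncovered {..<n} t \<sigma>)) /
      real (card (permutations_of_set (nsets {..<n} k))) \<le>
      M * ((1 + D * z) powr (- 1 / D) + (real q)\<^sup>2 * z\<^sup>2 * ((1 + \<rho> * q) ^ L) ^ 3 *
        (real (k - t) / real (n - t) * (2 * z + 1) + \<rho>))"
      using sum_num_uncovered_le[OF assms(1,2) n(1), of L]
      unfolding q_def[symmetric] M_def[symmetric] \<rho>_def[symmetric] z_def[symmetric] D(1)[symmetric] .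
    also have "\<dots> \<le> M * (K * ln (real n) powr (- 1 / D))"
      using main err M0 by (intro mult_left_mono) (auto simp: K_def algebra_simps)
    finally show ?case by (simp add: M_def mult_ac)
  qed
  moreover have "0 \<le> K" by (simp add: K_def)
  ultimately show ?thesis by blast
qed

section \<open>Hyperplanes and random point sets\<close>

lemma card_AG: "card (AG t p) = p ^ t"
  by (simp add: AG_def card_PiE)

lemma finite_AG: "finite (AG t p)"
  by (simp add: AG_def finite_PiE)

lemma AG_less: "x \<in> AG t p \<Longrightarrow> i < t \<Longrightarrow> x i < p"
  unfolding AG_def using PiE_mem by fastforce

definition hyperplane :: "nat \<Rightarrow> nat \<Rightarrow> (nat \<Rightarrow> nat) \<Rightarrow> nat \<Rightarrow> (nat \<Rightarrow> nat) set" where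
  "hyperplane t p a b = {x \<in> AG t p. [(\<Sum>i<t. a i * x i) = b] (mod p)}"

lemma hyperplanes_eq:
  "hyperplanes t p = {hyperplane t p a b |a b. \<exists>i<t. \<not> [a i = 0] (mod p)}"
  by (simp add: hyperplanes_def hyperplane_def)

lemma finite_hyperplanes: "finite (hyperplanes t p)"
proof (rule finite_subset)
  show "hyperplanes t p \<subseteq> Pow (AG t p)" by (auto simp: hyperplanes_def)
qed (simp add: finite_AG)

lemma coprime_prime_if_not_cong_0: "prime p \<Longrightarrow> \<not> [a = 0] (mod p) \<Longrightarrow> coprime a p" for a p :: nat
  by (metis cong_0_iff coprime_commute prime_imp_coprime)

text \<open>The coefficient \<open>a j\<close> is invertible modulo \<open>p\<close>, so the
  equation determines coordinate \<open>j\<close> from the others, which are arbitrary.\<close>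

lemma card_hyperplane:
  assumes "prime p" "j < t" "\<not> [a j = 0] (mod p)"
  shows "card (hyperplane t p a b) = p ^ (t - 1)"
proof -
  let ?J = "{..<t} - {j}" and ?H = "hyperplane t p a b"
  have p0: "0 < p" using assms(1) prime_gt_0_nat by blast
  have cop: "coprime (a j) p" using assms by (intro coprime_prime_if_not_cong_0)
  have split: "(\<Sum>i<t. a i * x i) = a j * x j + (\<Sum>i\<in>?J. a i * x i)" for x :: "nat \<Rightarrow> nat"
    using assms(2) by (intro sum.remove) auto
  have "bij_betw (\<lambda>x. restrict x ?J) ?H (?J \<rightarrow>\<^sub>E {..<p})"
    unfolding bij_betw_def
  proof (intro conjI equalityI)
    show "inj_on (\<lambda>x. restrict x ?J) ?H"
    proof (rule inj_onI)
      fix x y assume x: "x \<in> ?H" and y: "y \<in> ?H" and eq: "restrict x ?J = restrict y ?J"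
      have J: "x i = y i" if "i \<in> ?J" for i using eq that by (metis restrict_apply)
      hence "(\<Sum>i\<in>?J. a i * x i) = (\<Sum>i\<in>?J. a i * y i)" by (intro sum.cong) auto
      moreover have "[(\<Sum>i<t. a i * x i) = (\<Sum>i<t. a i * y i)] (mod p)"
        using x y by (auto simp: hyperplane_def intro: cong_trans cong_sym)
      ultimately have "[a j * x j = a j * y j] (mod p)"
        unfolding split by (simp add: cong_add_rcancel_nat)
      hence "[x j = y j] (mod p)" using cop by (simp add: cong_mult_lcancel_nat)
      moreover have "x j < p" "y j < p" using x y assms(2) by (auto simp: hyperplane_def AG_less)
      ultimately have "x j = y j" by (simp add: cong_less_modulus_unique_nat)
      hence "x i = y i" if "i \<in> {..<t}" for i using J that by (cases "i = j") auto
      thus "x = y" using x y by (auto simp: hyperplane_def AG_def intro: PiE_ext)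
    qed
    show "(\<lambda>x. restrict x ?J) ` ?H \<subseteq> ?J \<rightarrow>\<^sub>E {..<p}"
    proof (rule image_subsetI)
      fix x assume "x \<in> ?H"
      hence "x \<in> {..<t} \<rightarrow>\<^sub>E {..<p}" by (simp add: hyperplane_def AG_def)
      hence "x i \<in> {..<p}" if "i \<in> ?J" for i using that PiE_mem by blast
      thus "restrict x ?J \<in> ?J \<rightarrow>\<^sub>E {..<p}" unfolding restrict_PiE_iff by blast
    qed
    show "?J \<rightarrow>\<^sub>E {..<p} \<subseteq> (\<lambda>x. restrict x ?J) ` ?H"
    proof
      fix y assume y: "y \<in> ?J \<rightarrow>\<^sub>E {..<p}"
      let ?s = "\<Sum>i\<in>?J. a i * y i"
      obtain u where u: "[a j * u = 1] (mod p)" using cong_solve_coprime_nat[OF cop] by auto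
      \<comment> \<open>The solution for coordinate \<open>j\<close>; among natural numbers,
        \<open>(p - 1) * ?s\<close> serves as the negative of \<open>?s\<close> modulo
        \<open>p\<close>.\<close>
      define c where "c = (u * (b + (p - 1) * ?s)) mod p"
      define x where "x = y(j := c)"
      have "[a j * c = a j * (u * (b + (p - 1) * ?s))] (mod p)"
        unfolding c_def by (intro cong_mult cong_refl) (simp add: cong_def)
      also have "a j * (u * (b + (p - 1) * ?s)) = a j * u * (b + (p - 1) * ?s)" by simp
      also have "[\<dots> = 1 * (b + (p - 1) * ?s)] (mod p)" using u by (intro cong_mult cong_refl)
      finally have "[a j * c + ?s = 1 * (b + (p - 1) * ?s) + ?s] (mod p)"
        by (intro cong_add cong_refl)
      also have "1 * (b + (p - 1) * ?s) + ?s = b + p * ?s"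
        using p0 by (cases p) simp_all
      also have "[\<dots> = b] (mod p)" by (simp add: cong_def)
      finally have "[a j * c + ?s = b] (mod p)" .
      moreover have "(\<Sum>i\<in>?J. a i * x i) = ?s" unfolding x_def by (intro sum.cong) auto
      ultimately have "[(\<Sum>i<t. a i * x i) = b] (mod p)" unfolding split by (simp add: x_def)
      moreover have "x \<in> AG t p"
        unfolding AG_def
      proof (rule PiE_I)
        have "c < p" using p0 by (simp add: c_def)
        thus "x i \<in> {..<p}" if "i \<in> {..<t}" for i
          using that PiE_mem[OF y, of i] by (cases "i = j") (auto simp: x_def)
        show "x i = undefined" if "i \<notin> {..<t}" for i
          using that PiE_arb[OF y, of i] assms(2) by (auto simp: x_def)
      qed
      ultimately have "x \<in> ?H" by (simp add: hyperplane_def)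
      moreover have "y = restrict x ?J"
      proof
        show "y i = restrict x ?J i" for i using PiE_arb[OF y, of i] by (auto simp: x_def)
      qed
      ultimately show "y \<in> (\<lambda>x. restrict x ?J) ` ?H" by blast
    qed
  qed
  hence "card ?H = card (?J \<rightarrow>\<^sub>E {..<p})" by (rule bij_betw_same_card)
  also have "\<dots> = p ^ (t - 1)" using assms(2) by (simp add: card_PiE)
  finally show ?thesis .
qed

text \<open>Each hyperplane has at least \<open>p - 1\<close> equations, the multiples of any one of them.\<close>

lemma card_hyperplanes_le:
  assumes p: "prime p"
  shows "(p - 1) * card (hyperplanes t p) \<le> p * (p ^ t - 1)"
proof -
  have p0: "0 < p" using p prime_gt_0_nat by blast
  define Z where "Z = (\<lambda>i\<in>{..<t}. 0 :: nat)"
  define X where "X = (AG t p - {Z}) \<times> {..<p}"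
  define F where "F = (\<lambda>(a, b). hyperplane t p a b)"
  define mul where "mul = (\<lambda>c (a, b). ((\<lambda>i\<in>{..<t}. (c * a i) mod p), (c * b :: nat) mod p))"
  have Z: "Z \<in> AG t p" using p0 by (auto simp: Z_def AG_def)
  have finX: "finite X" by (simp add: X_def finite_AG)
  have cardX: "card X = p * (p ^ t - 1)"
    using Z by (simp add: X_def card_cartesian_product card_AG card_Diff_singleton)
  have mulF: "F (mul c (a, b)) = F (a, b)" if "coprime c p" for c a b
  proof -
    have "[(\<Sum>i<t. (\<lambda>i\<in>{..<t}. (c * a i) mod p) i * x i) = c * b mod p] (mod p) \<longleftrightarrow>
        [(\<Sum>i<t. a i * x i) = b] (mod p)" for x :: "nat \<Rightarrow> nat"
    proof -
      have "[(\<Sum>i<t. (\<lambda>i\<in>{..<t}. (c * a i) mod p) i * x i) = (\<Sum>i<t. c * a i * x i)] (mod p)"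
        by (intro cong_sum cong_mult cong_refl) (auto simp: cong_def)
      also have "(\<Sum>i<t. c * a i * x i) = c * (\<Sum>i<t. a i * x i)"
        by (simp add: sum_distrib_left mult.assoc)
      finally have "[(\<Sum>i<t. (\<lambda>i\<in>{..<t}. (c * a i) mod p) i * x i) = c * b mod p] (mod p) \<longleftrightarrow>
          [c * (\<Sum>i<t. a i * x i) = c * b] (mod p)" by (simp add: cong_def)
      thus ?thesis using that by (simp add: cong_mult_lcancel_nat)
    qed
    thus ?thesis by (simp add: F_def mul_def hyperplane_def)
  qed
  have nonzero: "\<exists>i<t. \<not> [a i = 0] (mod p)" if "a \<in> AG t p" "a \<noteq> Z" for a
  proof (rule ccontr)
    assume "\<not> ?thesis"
    hence "a i = 0" if "i < t" for i
      using AG_less[OF \<open>a \<in> AG t p\<close> that] that p0 cong_less_modulus_unique_nat[of "a i" 0 p] by simp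
    hence "a = Z" using that(1) Z by (intro PiE_ext[of a "{..<t}" "\<lambda>_. {..<p}" Z]) (auto simp: AG_def Z_def)
    thus False using that(2) by simp
  qed
  have fibre: "p - 1 \<le> card {x \<in> X. F x = H}" if H: "H \<in> hyperplanes t p" for H
  proof -
    obtain a0 b0 where ab0: "H = hyperplane t p a0 b0" "\<exists>i<t. \<not> [a0 i = 0] (mod p)"
      using H by (auto simp: hyperplanes_eq)
    \<comment> \<open>The equation of a hyperplane may have arbitrary natural coefficients; reducing
      them modulo \<open>p\<close> makes it an element of the finite set \<open>X\<close>.\<close>
    define a b where "a = (\<lambda>i\<in>{..<t}. a0 i mod p)" and "b = b0 mod p"
    have ab: "mul 1 (a0, b0) = (a, b)" by (simp add: mul_def a_def b_def)
    have HF: "H = F (a, b)" using mulF[of 1 a0 b0] ab0 ab by (simp add: F_def)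
    obtain j where j: "j < t" "\<not> [a j = 0] (mod p)" using ab0 by (auto simp: a_def)
    have cop: "coprime c p" if "c \<in> {1..<p}" for c
    proof (rule coprime_prime_if_not_cong_0[OF p])
      show "\<not> [c = 0] (mod p)" using that by (simp add: cong_def)
    qed
    have "inj_on (\<lambda>c. mul c (a, b)) {1..<p}"
    proof (rule inj_onI)
      fix c d assume c: "c \<in> {1..<p}" and d: "d \<in> {1..<p}" and eq: "mul c (a, b) = mul d (a, b)"
      have "(\<lambda>i\<in>{..<t}. (c * a i) mod p) j = (\<lambda>i\<in>{..<t}. (d * a i) mod p) j"
        using eq by (auto simp: mul_def)
      hence "[c * a j = d * a j] (mod p)" using j by (simp add: cong_def)
      hence "[c = d] (mod p)"
        using coprime_prime_if_not_cong_0[OF p j(2)] by (simp add: cong_mult_rcancel_nat)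
      thus "c = d" using c d by (simp add: cong_less_modulus_unique_nat)
    qed
    moreover have "(\<lambda>c. mul c (a, b)) ` {1..<p} \<subseteq> {x \<in> X. F x = H}"
    proof
      fix y assume "y \<in> (\<lambda>c. mul c (a, b)) ` {1..<p}"
      then obtain c where c: "c \<in> {1..<p}" "y = mul c (a, b)" by blast
      let ?a = "\<lambda>i\<in>{..<t}. (c * a i) mod p"
      have "?a \<noteq> Z"
      proof
        assume "?a = Z"
        hence "?a j = Z j" by simp
        hence "[c * a j = c * 0] (mod p)" using j by (simp add: Z_def cong_def)
        thus False using j cop[OF c(1)] cong_mult_lcancel_nat[of c p "a j" 0] by simp
      qed
      moreover have "?a \<in> AG t p" using p0 by (auto simp: AG_def)
      ultimately have "y \<in> X" using c p0 by (simp add: X_def mul_def)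
      thus "y \<in> {x \<in> X. F x = H}" using mulF[OF cop[OF c(1)]] HF c by simp
    qed
    ultimately have "card {1..<p} \<le> card {x \<in> X. F x = H}"
      using finX by (intro card_inj_on_le) auto
    thus ?thesis by simp
  qed
  have "F ` X \<subseteq> hyperplanes t p" using nonzero by (auto simp: F_def X_def hyperplanes_eq)
  have "card (hyperplanes t p) * (p - 1) \<le> (\<Sum>H\<in>hyperplanes t p. card {x \<in> X. F x = H})"
    using fibre sum_mono[of "hyperplanes t p" "\<lambda>_. p - 1"] by simp
  also have "\<dots> = card X"
    using sum.group[OF finX finite_hyperplanes \<open>F ` X \<subseteq> hyperplanes t p\<close>, of "\<lambda>_. 1 :: nat"] by simp
  finally show ?thesis using cardX by (simp add: mult.commute)
qed

text \<open>Pigeonhole principle: two of the \<open>p ^ t\<close> linear forms agree on the \<open>t - 1\<close> differences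
  \<open>x - x0\<close> of points of \<open>T\<close>.\<close>

lemma hyperplane_through_points:
  assumes p: "prime p" and T: "T \<subseteq> AG t p" "card T = t" and t: "1 \<le> t"
  shows "\<exists>H\<in>hyperplanes t p. T \<subseteq> H"
proof -
  have p1: "1 < p" using p prime_gt_1_nat by blast
  have finT: "finite T" using T(1) finite_AG finite_subset by blast
  obtain x0 where x0: "x0 \<in> T" using T t by (metis all_not_in_conv card.empty not_one_le_zero)
  \<comment> \<open>Taking differences with \<open>x0\<close> removes the constant term and makes
    the value at \<open>x0\<close> vanish, so that only \<open>p ^ (t - 1)\<close> value patterns
    remain.\<close>
  define form where "form = (\<lambda>(a :: nat \<Rightarrow> nat) (x :: nat \<Rightarrow> nat). \<Sum>i<t. int (a i) * (int (x i) - int (x0 i)))"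
  define \<Phi> where "\<Phi> = (\<lambda>a. \<lambda>x\<in>T - {x0}. nat (form a x mod int p))"
  have "\<Phi> ` AG t p \<subseteq> (T - {x0}) \<rightarrow>\<^sub>E {..<p}"
  proof (rule image_subsetI)
    fix a
    have "nat (z mod int p) \<in> {..<p}" for z using p1 by (simp add: nat_less_iff)
    thus "\<Phi> a \<in> (T - {x0}) \<rightarrow>\<^sub>E {..<p}" unfolding \<Phi>_def restrict_PiE_iff by blast
  qed
  hence "card (\<Phi> ` AG t p) \<le> card ((T - {x0}) \<rightarrow>\<^sub>E {..<p})"
    using finT by (intro card_mono finite_PiE) auto
  also have "\<dots> = p ^ (t - 1)" using finT x0 T by (simp add: card_PiE)
  also have "\<dots> < p ^ t" using p1 t by (intro power_strict_increasing) auto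
  finally have "\<not> inj_on \<Phi> (AG t p)" using card_image[of \<Phi> "AG t p"] by (auto simp: card_AG)
  then obtain a a' where a: "a \<in> AG t p" "a' \<in> AG t p" "a \<noteq> a'" "\<Phi> a = \<Phi> a'"
    by (auto simp: inj_on_def)
  have form: "[form a x = form a' x] (mod int p)" if x: "x \<in> T" for x
  proof (cases "x = x0")
    case False
    hence "\<Phi> a x = nat (form a x mod int p)" "\<Phi> a' x = nat (form a' x mod int p)"
      using x by (simp_all add: \<Phi>_def)
    thus ?thesis using a(4) p1 by (simp add: cong_def eq_nat_nat_iff)
  qed (simp add: form_def)
  \<comment> \<open>The difference of the two linear forms, shifted by \<open>p\<close> to stay
    within the natural numbers.\<close>
  define d where "d = (\<lambda>i. a i + (p - a' i))"
  have d: "int (d i) = int (a i) - int (a' i) + int p" if "i < t" for i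
    using AG_less[OF a(2) that] by (simp add: d_def of_nat_diff)
  define b where "b = (\<Sum>i<t. d i * x0 i)"
  have "T \<subseteq> hyperplane t p d b"
  proof
    fix x assume x: "x \<in> T"
    have "int (\<Sum>i<t. d i * x i) - int b = (\<Sum>i<t. int (d i) * (int (x i) - int (x0 i)))"
      by (simp only: b_def of_nat_sum of_nat_mult right_diff_distrib sum_subtractf)
    also have "\<dots> = (\<Sum>i<t. (int (a i) * (int (x i) - int (x0 i)) - int (a' i) * (int (x i) - int (x0 i)))
        + int p * (int (x i) - int (x0 i)))"
      by (intro sum.cong refl) (simp add: d algebra_simps)
    also have "\<dots> = (form a x - form a' x) + int p * (\<Sum>i<t. int (x i) - int (x0 i))"
      by (simp add: sum.distrib sum_subtractf form_def sum_distrib_left right_diff_distrib)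
    finally have "int p dvd int (\<Sum>i<t. d i * x i) - int b"
      using form[OF x] by (simp add: cong_iff_dvd_diff)
    hence "[int (\<Sum>i<t. d i * x i) = int b] (mod int p)" by (simp add: cong_iff_dvd_diff)
    hence "[(\<Sum>i<t. d i * x i) = b] (mod p)" by (simp only: cong_int_iff)
    thus "x \<in> hyperplane t p d b" using x T by (auto simp: hyperplane_def)
  qed
  moreover have "\<exists>j<t. \<not> [d j = 0] (mod p)"
  proof -
    obtain j where j: "j < t" "a j \<noteq> a' j"
    proof (rule ccontr)
      assume "\<not> thesis"
      hence "a i = a' i" if "i \<in> {..<t}" for i using \<open>\<And>j. j < t \<Longrightarrow> a j \<noteq> a' j \<Longrightarrow> thesis\<close> that by auto
      hence "a = a'" using PiE_ext a(1,2) unfolding AG_def by blast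
      thus False using a(3) by simp
    qed
    have lt: "a j < p" "a' j < p" using a j by (simp_all add: AG_less)
    have "\<not> [d j = 0] (mod p)"
    proof
      assume "[d j = 0] (mod p)"
      hence "int p dvd int (d j)" by (simp add: cong_0_iff)
      hence "int p dvd int (a j) - int (a' j)" using d[OF j(1)] by simp
      hence "[int (a j) = int (a' j)] (mod int p)" by (simp add: cong_iff_dvd_diff)
      hence "[a j = a' j] (mod p)" by (simp only: cong_int_iff)
      thus False using lt j by (simp add: cong_less_modulus_unique_nat)
    qed
    thus ?thesis using j by blast
  qed
  ultimately show ?thesis by (auto simp: hyperplanes_eq)
qed

section \<open>Moments of the intersection with a random point set\<close>

lemma Suc_times_binomial_real:
  "real (Suc j) * real (n choose Suc j) = (real n - real j) * real (n choose j)"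
proof (cases "j \<le> n")
  case True
  have "Suc j * (n choose Suc j) = (n - j) * (n choose j)"
    by (metis binomial_absorb_comp binomial_absorption)
  hence "real (Suc j) * real (n choose Suc j) = real (n - j) * real (n choose j)"
    by (metis of_nat_mult)
  thus ?thesis using True by (simp add: of_nat_diff)
next
  \<comment> \<open>For \<open>j > n\<close> both sides vanish, so the identity applies to
    intersections of any size.\<close>
  case False
  thus ?thesis by (simp add: binomial_eq_0 del: binomial_Suc_Suc)
qed

text \<open>The expectation of \<open>N choose j\<close> for a hypergeometric \<open>N\<close>: the
  size of the intersection of a fixed \<open>h\<close>-set and a random \<open>v\<close>-set among
  \<open>P\<close> points.\<close>

definition hypergeom_moment :: "nat \<Rightarrow> nat \<Rightarrow> nat \<Rightarrow> nat \<Rightarrow> real" where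
  "hypergeom_moment P h v j = real (h choose j) * real (v choose j) / real (P choose j)"

lemma sum_choose_Int:
  assumes "finite \<Omega>" "card \<Omega> = P" "X \<subseteq> \<Omega>" "card X = h" "v \<le> P" "j \<le> v"
  shows "(\<Sum>V\<in>nsets \<Omega> v. real (card (X \<inter> V) choose j)) = real (P choose v) * hypergeom_moment P h v j"
proof -
  have finX: "finite X" using assms finite_subset by blast
  have fin: "finite (nsets \<Omega> v)" "finite (nsets X j)"
    using assms finX by (auto intro: finite_imp_finite_nsets)
  have "real (card (X \<inter> V) choose j) = (\<Sum>S\<in>nsets X j. of_bool (S \<subseteq> V))" for V
  proof -
    have "real (card (X \<inter> V) choose j) = real (card (nsets (X \<inter> V) j))" by (simp add: card_nsets)
    also have "nsets (X \<inter> V) j = {S \<in> nsets X j. S \<subseteq> V}" by (auto simp: nsets_def)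
    also have "real (card \<dots>) = (\<Sum>S\<in>{S \<in> nsets X j. S \<subseteq> V}. 1)" by simp
    also have "\<dots> = (\<Sum>S\<in>nsets X j. of_bool (S \<subseteq> V))"
      using fin by (intro sum.mono_neutral_cong_left) auto
    finally show ?thesis .
  qed
  hence "(\<Sum>V\<in>nsets \<Omega> v. real (card (X \<inter> V) choose j)) =
      (\<Sum>S\<in>nsets X j. \<Sum>V\<in>nsets \<Omega> v. of_bool (S \<subseteq> V))"
    by (simp only:) (rule sum.swap)
  also have "\<dots> = (\<Sum>S\<in>nsets X j. real ((P - j) choose (v - j)))"
  proof (intro sum.cong refl)
    fix S assume S: "S \<in> nsets X j"
    have "(\<Sum>V\<in>nsets \<Omega> v. of_bool (S \<subseteq> V)) = (\<Sum>V\<in>{V \<in> nsets \<Omega> v. S \<subseteq> V}. 1 :: real)"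
      using fin by (intro sum.mono_neutral_cong_right) auto
    also have "\<dots> = real (card {V \<in> nsets \<Omega> v. S \<subseteq> V})" by simp
    also have "card {V \<in> nsets \<Omega> v. S \<subseteq> V} = (P - j) choose (v - j)"
      using S assms card_supersets[of \<Omega> S v] by (auto simp: nsets_def)
    finally show "(\<Sum>V\<in>nsets \<Omega> v. of_bool (S \<subseteq> V)) = real ((P - j) choose (v - j))" .
  qed
  also have "\<dots> = real (h choose j) * real ((P - j) choose (v - j))"
    using assms by (simp add: card_nsets)
  also have "real ((P - j) choose (v - j)) = real (P choose v) * real (v choose j) / real (P choose j)"
  proof -
    have "(P choose v) * (v choose j) = (P choose j) * ((P - j) choose (v - j))"
      using assms by (intro choose_mult) auto
    hence "real (P choose v) * real (v choose j) = real (P choose j) * real ((P - j) choose (v - j))"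
      by (metis of_nat_mult)
    moreover have "P choose j > 0" using assms by (simp add: zero_less_binomial_iff)
    ultimately show ?thesis by (simp add: field_simps)
  qed
  finally show ?thesis by (simp add: hypergeom_moment_def)
qed

text \<open>For \<open>j = t\<close> the factor on the right is the mean of the intersection size
  minus \<open>t\<close> under the biased law. This is the \<mu> of the deviation bound.\<close>

lemma hypergeom_moment_Suc:
  assumes "j < P"
  shows "real (Suc j) * hypergeom_moment P h v (Suc j) =
    hypergeom_moment P h v j * ((real h - real j) * (real v - real j) / (real P - real j))"
proof -
  have P: "0 < real (P choose j)" "0 < real (P choose Suc j)"
    using assms by (simp_all add: zero_less_binomial_iff)
  have "real (Suc j) * hypergeom_moment P h v (Suc j) =
      (real (Suc j) * real (h choose Suc j)) * (real (Suc j) * real (v choose Suc j)) /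
      (real (Suc j) * real (P choose Suc j))"
    unfolding hypergeom_moment_def by (simp del: of_nat_Suc binomial_Suc_Suc)
  also have "\<dots> = ((real h - real j) * real (h choose j)) * ((real v - real j) * real (v choose j)) /
      ((real P - real j) * real (P choose j))"
    by (simp only: Suc_times_binomial_real)
  finally show ?thesis by (simp add: hypergeom_moment_def mult_ac)
qed

lemma hypergeom_moment_nonneg: "0 \<le> hypergeom_moment P h v j"
  by (simp add: hypergeom_moment_def)

text \<open>Chebyshev's inequality for the intersection size, under the law biased by the number of
  \<open>t\<close>-subsets of the intersection.\<close>

lemma sum_choose_Int_deviation:
  assumes "finite \<Omega>" "card \<Omega> = P" "X \<subseteq> \<Omega>" "card X = h" "v \<le> P" "t + 2 \<le> v" "t + 2 \<le> h"
  defines "\<mu> \<equiv> (real h - real t) * (real v - real t) / (real P - real t)"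
  assumes "0 < \<delta>" and bad: "\<And>V. V \<in> nsets \<Omega> v \<Longrightarrow> bad V \<Longrightarrow> \<delta> \<le> \<bar>real (card (X \<inter> V)) - real t - \<mu>\<bar>"
  shows "(\<Sum>V\<in>nsets \<Omega> v. of_bool (bad V) * real (card (X \<inter> V) choose t)) \<le>
    real (P choose v) * hypergeom_moment P h v t * (\<mu> / \<delta>\<^sup>2)"
proof -
  let ?c = "\<lambda>V. card (X \<inter> V)" and ?m = "hypergeom_moment P h v"
  have hP: "h \<le> P" using assms card_mono by blast
  have "(\<Sum>V\<in>nsets \<Omega> v. of_bool (bad V) * real (?c V choose t)) \<le>
      (\<Sum>V\<in>nsets \<Omega> v. real (?c V choose t) * (real (?c V) - real t - \<mu>)\<^sup>2 / \<delta>\<^sup>2)"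
  proof (intro sum_mono)
    fix V assume V: "V \<in> nsets \<Omega> v"
    show "of_bool (bad V) * real (?c V choose t) \<le> real (?c V choose t) * (real (?c V) - real t - \<mu>)\<^sup>2 / \<delta>\<^sup>2"
    proof (cases "bad V")
      case True
      hence "\<delta>\<^sup>2 \<le> (real (?c V) - real t - \<mu>)\<^sup>2"
        using bad[OF V] assms(9) by (metis abs_le_square_iff abs_of_pos)
      hence "real (?c V choose t) * 1 \<le> real (?c V choose t) * ((real (?c V) - real t - \<mu>)\<^sup>2 / \<delta>\<^sup>2)"
        using assms(9) by (intro mult_left_mono) (auto simp: field_simps)
      thus ?thesis using True by simp
    qed simp
  qed
  \<comment> \<open>The weighted square is expanded in the binomials at \<open>t\<close>,
    \<open>t + 1\<close> and \<open>t + 2\<close>, whose sums are known exactly.\<close>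
  also have "\<dots> = (\<Sum>V\<in>nsets \<Omega> v. real (t+1) * real (t+2) * real (?c V choose (t+2)) +
      (real (t+1) * (1 - 2 * \<mu>) * real (?c V choose (t+1)) + \<mu>\<^sup>2 * real (?c V choose t))) / \<delta>\<^sup>2"
    unfolding sum_divide_distrib
  proof (intro sum.cong refl arg_cong2[of _ _ _ _ "(/)"])
    fix V
    have 1: "real (t+1) * real (?c V choose (t+1)) = (real (?c V) - real t) * real (?c V choose t)"
      using Suc_times_binomial_real[of t "?c V"] by simp
    have "real (t+2) * real (?c V choose (t+2)) = (real (?c V) - real t - 1) * real (?c V choose (t+1))"
      using Suc_times_binomial_real[of "Suc t" "?c V"] by (simp add: algebra_simps del: binomial_Suc_Suc)
    hence "real (t+1) * real (t+2) * real (?c V choose (t+2)) =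
        (real (?c V) - real t - 1) * ((real (?c V) - real t) * real (?c V choose t))"
      using 1 by (metis mult.assoc mult.left_commute)
    thus "real (?c V choose t) * (real (?c V) - real t - \<mu>)\<^sup>2 =
      real (t+1) * real (t+2) * real (?c V choose (t+2)) +
      (real (t+1) * (1 - 2 * \<mu>) * real (?c V choose (t+1)) + \<mu>\<^sup>2 * real (?c V choose t))"
      using arg_cong[OF 1, of "\<lambda>z. (1 - 2 * \<mu>) * z"] by (simp add: power2_eq_square algebra_simps)
  qed
  also have "\<dots> = real (P choose v) * (real (t+1) * (real (t+2) * ?m (t+2)) +
      ((1 - 2 * \<mu>) * (real (t+1) * ?m (t+1)) + \<mu>\<^sup>2 * ?m t)) / \<delta>\<^sup>2"
  proof -
    have s: "(\<Sum>V\<in>nsets \<Omega> v. real (?c V choose j)) = real (P choose v) * ?m j" if "j \<le> t + 2" for j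
      using assms that by (intro sum_choose_Int) auto
    have s2: "(\<Sum>V\<in>nsets \<Omega> v. real (?c V choose (t+2))) = real (P choose v) * ?m (t+2)" by (rule s) simp
    have s1: "(\<Sum>V\<in>nsets \<Omega> v. real (?c V choose (t+1))) = real (P choose v) * ?m (t+1)" by (rule s) simp
    have s0: "(\<Sum>V\<in>nsets \<Omega> v. real (?c V choose t)) = real (P choose v) * ?m t" by (rule s) simp
    show ?thesis unfolding sum.distrib sum_distrib_left[symmetric] s0 s1 s2 by (simp add: algebra_simps)
  qed
  also have "\<dots> \<le> real (P choose v) * (\<mu> * ?m t) / \<delta>\<^sup>2"
  proof (intro divide_right_mono mult_left_mono)
    define \<mu>' where "\<mu>' = (real h - real (t+1)) * (real v - real (t+1)) / (real P - real (t+1))"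
    have m1: "real (t+1) * ?m (t+1) = ?m t * \<mu>"
      using hypergeom_moment_Suc[of t P h v] assms(5,6) by (simp add: \<mu>_def)
    have m2: "real (t+2) * ?m (t+2) = ?m (t+1) * \<mu>'"
      using hypergeom_moment_Suc[of "t+1" P h v] assms(5,6) by (simp add: \<mu>'_def)
    have \<mu>0: "0 \<le> \<mu>" using assms(5-7) by (simp add: \<mu>_def)
    \<comment> \<open>Sampling is without replacement, so the next ratio is no larger; the biased
      variance \<open>\<mu> * \<mu>' + \<mu> - \<mu>\<^sup>2\<close> is therefore at most the mean
      \<mu>.\<close>
    have "\<mu>' \<le> \<mu>"
    proof -
      have "(real h - real (t+1)) / (real P - real (t+1)) \<le> (real h - real t) / (real P - real t)"
        using hP assms(5-7) by (simp add: field_simps)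
      hence "(real h - real (t+1)) / (real P - real (t+1)) * (real v - real (t+1)) \<le>
          (real h - real t) / (real P - real t) * (real v - real t)"
        using hP assms(5-7) by (intro mult_mono) auto
      thus ?thesis by (simp add: \<mu>_def \<mu>'_def)
    qed
    have "real (t+1) * (real (t+2) * ?m (t+2)) = (?m t * \<mu>) * \<mu>'"
      unfolding m2 m1[symmetric] by simp
    also have "\<dots> \<le> (?m t * \<mu>) * \<mu>"
      using \<open>\<mu>' \<le> \<mu>\<close> \<mu>0 hypergeom_moment_nonneg by (intro mult_left_mono) auto
    finally show "real (t+1) * (real (t+2) * ?m (t+2)) +
      ((1 - 2 * \<mu>) * (real (t+1) * ?m (t+1)) + \<mu>\<^sup>2 * ?m t) \<le> \<mu> * ?m t"
      unfolding m1 by (simp add: power2_eq_square algebra_simps)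
  qed auto
  finally show ?thesis by (simp add: mult_ac)
qed

section \<open>Induced coverings\<close>

lemma is_covering_image:
  assumes f: "bij_betw f {..<n} X" and C: "is_covering {..<n} n k t C"
  shows "is_covering X n k t (image_mset ((`) f) C)"
  unfolding is_covering_def
proof (intro conjI ballI)
  have inj: "inj_on f {..<n}" and im: "f ` {..<n} = X" using f by (auto simp: bij_betw_def)
  show "finite X" using im by blast
  show "card X = n" using bij_betw_same_card[OF f] by simp
  show "set_mset (image_mset ((`) f) C) \<subseteq> nsets X k"
  proof
    fix c assume "c \<in># image_mset ((`) f) C"
    then obtain b where b: "b \<in># C" "c = f ` b" by auto
    hence "b \<in> nsets {..<n} k" using C by (auto simp: is_covering_def)
    hence b': "b \<subseteq> {..<n}" "card b = k" "finite b" by (auto simp: nsets_def)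
    have "card c = k" using b b' inj card_image inj_on_subset by metis
    thus "c \<in> nsets X k" using b b' im by (auto simp: nsets_def)
  qed
  fix T assume T: "T \<in> nsets X t"
  define S where "S = {i \<in> {..<n}. f i \<in> T}"
  have fS: "f ` S = T" using T im by (auto simp: S_def nsets_def)
  have "inj_on f S" using inj by (rule inj_on_subset) (auto simp: S_def)
  hence "card S = t" using card_image[of f S] T fS by (auto simp: nsets_def)
  hence "S \<in> nsets {..<n} t" by (auto simp: nsets_def S_def)
  then obtain b where "b \<in># C" "S \<subseteq> b" using C by (auto simp: is_covering_def)
  thus "\<exists>c\<in>#image_mset ((`) f) C. T \<subseteq> c" using fS by auto
qed

lemma covering_density_eq:
  assumes "finite V" "set_mset \<B> \<subseteq> nsets V k"
  shows "covering_density t V \<B> = real (k choose t) * real (size \<B>) / real (card V choose t)"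
proof -
  have fin: "finite (nsets V t)" using assms(1) by (rule finite_imp_finite_nsets)
  have "(\<Sum>T\<in>nsets V t. real (size {#b \<in># \<B>. T \<subseteq> b#})) = real (k choose t) * real (size \<B>)"
    using assms(2)
  proof (induction \<B>)
    case (add b \<B>)
    have b: "b \<in> nsets V k" using add.prems by simp
    have "real (size {#c \<in># add_mset b \<B>. T \<subseteq> c#}) = of_bool (T \<subseteq> b) + real (size {#c \<in># \<B>. T \<subseteq> c#})" for T
      by simp
    moreover have "(\<Sum>T\<in>nsets V t. of_bool (T \<subseteq> b)) = real (k choose t)"
    proof -
      have "(\<Sum>T\<in>nsets V t. of_bool (T \<subseteq> b)) = (\<Sum>T\<in>nsets b t. 1 :: real)"
        using fin b by (intro sum.mono_neutral_cong_right) (auto simp: nsets_def)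
      thus ?thesis using b by (simp add: card_nsets) (simp add: nsets_def)
    qed
    ultimately show ?case using add by (simp add: sum.distrib algebra_simps)
  qed simp
  thus ?thesis by (simp add: covering_density_def card_nsets)
qed

lemma covering_density_ge_1:
  assumes "is_covering V v k t \<B>" "t \<le> v"
  shows "1 \<le> covering_density t V \<B>"
proof -
  have cov: "card V = v" "\<forall>T\<in>nsets V t. \<exists>b\<in>#\<B>. T \<subseteq> b"
    using assms(1) by (auto simp: is_covering_def)
  have "1 \<le> size {#b \<in># \<B>. T \<subseteq> b#}" if T: "T \<in> nsets V t" for T
  proof -
    obtain b where "b \<in># \<B>" "T \<subseteq> b" using cov(2) T by blast
    hence "b \<in># {#b \<in># \<B>. T \<subseteq> b#}" by simp
    hence "0 < size {#b \<in># \<B>. T \<subseteq> b#}" by (metis empty_iff nonempty_has_size set_mset_empty)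
    thus ?thesis by linarith
  qed
  hence "(\<Sum>T\<in>nsets V t. 1) \<le> (\<Sum>T\<in>nsets V t. real (size {#b \<in># \<B>. T \<subseteq> b#}))"
    by (intro sum_mono) (metis of_nat_1 of_nat_mono)
  moreover have "0 < card (nsets V t)" using assms(2) cov by (simp add: card_nsets zero_less_binomial_iff)
  ultimately show ?thesis by (simp add: covering_density_def)
qed

text \<open>The smallest covering is no larger than that of run 0, so it is controlled by a single
  uniformly random ordering and the law of the minimum never has to be analysed.\<close>

lemma best_greedy_coveringD:
  assumes "best_greedy_covering n k t r \<sigma> \<B>" "1 \<le> r" "t \<le> k"
    and "\<And>i. i < r \<Longrightarrow> \<sigma> i \<in> permutations_of_set (nsets {..<n} k)"
  shows "is_covering {..<n} n k t \<B>"
    and "real (k choose t) * real (size \<B>) \<le>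
      real (n choose t) + (real (k choose t) - 1) * real (num_uncovered {..<n} t (\<sigma> 0))"
proof -
  obtain R where R: "\<forall>i<r. greedy_covering n k t (\<sigma> i) (R i)" "\<B> \<in> R ` {..<r}"
    "\<forall>i<r. size \<B> \<le> size (R i)" using assms(1) by (auto simp: best_greedy_covering_def)
  obtain i where "i < r" "\<B> = R i" using R(2) by auto
  thus "is_covering {..<n} n k t \<B>" using R(1) assms(4) greedy_covering_is_covering by blast
  have "real (k choose t) * real (size \<B>) \<le> real (k choose t) * real (size (R 0))"
    using R(3) assms(2) by (intro mult_left_mono) auto
  also have "\<dots> = real (n choose t) + (real (k choose t) - 1) * real (num_uncovered {..<n} t (\<sigma> 0))"
    using R(1) assms by (intro greedy_covering_size) auto
  finally show "real (k choose t) * real (size \<B>) \<le>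
      real (n choose t) + (real (k choose t) - 1) * real (num_uncovered {..<n} t (\<sigma> 0))" .
qed

text \<open>The size bound holds outcome by outcome and mentions only \<sigma> and \<open>V\<close>,
  not the choices left open. It charges each \<open>t\<close>-subset of an exceptional section with
  a whole block, that is \<open>k choose t\<close> after the scaling.\<close>

lemma induced_coveringD:
  assumes ind: "induced_covering v k t p r (\<sigma>, V) \<B>"
    and V: "V \<in> nsets (AG t p) v" and p: "prime p" and t: "1 \<le> t" "t \<le> k" and r: "1 \<le> r"
    and \<sigma>: "\<And>n i. n \<in> precomputed_sizes t v \<Longrightarrow> i < r \<Longrightarrow> \<sigma> (n, i) \<in> permutations_of_set (nsets {..<n} k)"
  shows "is_covering V v k t \<B>"
    and "real (k choose t) * real (size \<B>) \<le> (\<Sum>H\<in>hyperplanes t p.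
       if card (H \<inter> V) \<in> precomputed_sizes t v
       then real (card (H \<inter> V) choose t) +
         (real (k choose t) - 1) * real (num_uncovered {..<card (H \<inter> V)} t (\<sigma> (card (H \<inter> V), 0)))
       else real (k choose t) * real (card (H \<inter> V) choose t))" (is "_ \<le> (\<Sum>H\<in>_. ?bound H)")
proof -
  have V': "V \<subseteq> AG t p" "finite V" "card V = v" using V by (auto simp: nsets_def)
  obtain \<C> \<D> where C: "\<forall>n\<in>precomputed_sizes t v. best_greedy_covering n k t r (\<lambda>i. \<sigma> (n, i)) (\<C> n)"
    and D: "\<forall>H\<in>hyperplanes t p.
          let X = H \<inter> V; n = card X in
          if n \<in> precomputed_sizes t v
          then \<exists>f. bij_betw f {..<n} X \<and> \<D> H = image_mset ((`) f) (\<C> n)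
          else \<exists>g. (\<forall>T\<in>nsets X t. g T \<in> nsets V k \<and> T \<subseteq> g T) \<and>
                 \<D> H = image_mset g (mset_set (nsets X t))"
    and \<B>: "\<B> = (\<Sum>H\<in>hyperplanes t p. \<D> H)"
    using ind by (auto simp: induced_covering_def)
  have H: "set_mset (\<D> H) \<subseteq> nsets V k \<and> (\<forall>T\<in>nsets (H \<inter> V) t. \<exists>b\<in>#\<D> H. T \<subseteq> b) \<and>
      real (k choose t) * real (size (\<D> H)) \<le> ?bound H" if H: "H \<in> hyperplanes t p" for H
  proof (cases "card (H \<inter> V) \<in> precomputed_sizes t v")
    case True
    define n where "n = card (H \<inter> V)"
    have n: "n \<in> precomputed_sizes t v" using True by (simp add: n_def)
    obtain f where f: "bij_betw f {..<n} (H \<inter> V)" "\<D> H = image_mset ((`) f) (\<C> n)"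
      using bspec[OF D H] True by (auto simp: Let_def n_def)
    have best: "is_covering {..<n} n k t (\<C> n)" "real (k choose t) * real (size (\<C> n)) \<le>
      real (n choose t) + (real (k choose t) - 1) * real (num_uncovered {..<n} t (\<sigma> (n, 0)))"
      using best_greedy_coveringD[OF bspec[OF C n] r t(2)] \<sigma>[OF n] by auto
    have "is_covering (H \<inter> V) n k t (\<D> H)" unfolding f(2) by (rule is_covering_image[OF f(1) best(1)])
    moreover have "nsets (H \<inter> V) k \<subseteq> nsets V k" by (auto simp: nsets_def)
    ultimately show ?thesis using best(2) True f(2) by (auto simp: is_covering_def n_def)
  next
    case False
    then obtain g where g: "\<forall>T\<in>nsets (H \<inter> V) t. g T \<in> nsets V k \<and> T \<subseteq> g T"
      "\<D> H = image_mset g (mset_set (nsets (H \<inter> V) t))"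
      using bspec[OF D H] False by (auto simp: Let_def)
    have fin: "finite (nsets (H \<inter> V) t)" using V'(2) by (intro finite_imp_finite_nsets) auto
    have "size (\<D> H) = card (H \<inter> V) choose t" by (simp add: g(2) card_nsets)
    moreover have "\<exists>b\<in>#\<D> H. T \<subseteq> b" if "T \<in> nsets (H \<inter> V) t" for T
      using g that fin by (intro bexI[of _ "g T"]) auto
    ultimately show ?thesis using g fin False by auto
  qed
  have sum: "set_mset \<B> = (\<Union>H\<in>hyperplanes t p. set_mset (\<D> H))"
    unfolding \<B> by (rule set_mset_sum[OF finite_hyperplanes])
  show "is_covering V v k t \<B>" unfolding is_covering_def
  proof (intro conjI ballI)
    show "set_mset \<B> \<subseteq> nsets V k" unfolding sum using H by (intro UN_least) auto
    fix T assume T: "T \<in> nsets V t"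
    hence "T \<subseteq> AG t p" "card T = t" using V' by (auto simp: nsets_def)
    then obtain H0 where H0: "H0 \<in> hyperplanes t p" "T \<subseteq> H0"
      using hyperplane_through_points p t(1) by blast
    hence "T \<in> nsets (H0 \<inter> V) t" using T by (auto simp: nsets_def)
    then obtain b where "b \<in># \<D> H0" "T \<subseteq> b" using H[OF H0(1)] by blast
    thus "\<exists>b\<in>#\<B>. T \<subseteq> b" using sum H0(1) by blast
  qed (use V' in auto)
  have "real (k choose t) * real (size \<B>) = (\<Sum>H\<in>hyperplanes t p. real (k choose t) * real (size (\<D> H)))"
    by (simp add: \<B> sum_distrib_left)
  also have "\<dots> \<le> (\<Sum>H\<in>hyperplanes t p. ?bound H)" using H by (intro sum_mono) blast
  finally show "real (k choose t) * real (size \<B>) \<le> (\<Sum>H\<in>hyperplanes t p. ?bound H)" .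
qed

section \<open>Expected density of the induced covering\<close>

lemma expectation_pair_pmf_finite:
  fixes f :: "'a \<times> 'b \<Rightarrow> real"
  assumes "finite (set_pmf P)" "finite (set_pmf Q)"
  shows "measure_pmf.expectation (pair_pmf P Q) f =
    measure_pmf.expectation P (\<lambda>a. measure_pmf.expectation Q (\<lambda>b. f (a, b)))"
proof -
  have "pair_pmf P Q = bind_pmf P (\<lambda>a. map_pmf (Pair a) Q)"
    by (simp add: pair_pmf_def map_pmf_def)
  hence "measure_pmf.expectation (pair_pmf P Q) f =
      (\<Sum>a\<in>set_pmf P. pmf P a *\<^sub>R measure_pmf.expectation (map_pmf (Pair a) Q) f)"
    using assms by (simp only:) (rule pmf_expectation_bind, auto)
  also have "\<dots> = measure_pmf.expectation P (\<lambda>a. measure_pmf.expectation Q (\<lambda>b. f (a, b)))"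
    using assms(1) by (subst integral_measure_pmf[of "set_pmf P"]) auto
  finally show ?thesis .
qed

text \<open>Factor by factor, \<open>p * (h - j) \<le> p * h - j\<close>. With
  \<open>p * h = p ^ t\<close> it says that a random \<open>t\<close>-set lies in a given hyperplane
  with probability at most \<open>1 / p ^ t\<close>.\<close>

lemma binomial_mult_power_le: "(h choose j) * p ^ j \<le> (p * h) choose j" if "1 \<le> p"
proof (induction j)
  case (Suc j)
  show ?case
  proof (cases "Suc j \<le> h")
    case True
    have S: "Suc j * (n choose Suc j) = (n - j) * (n choose j)" for n
      by (metis binomial_absorb_comp binomial_absorption)
    have "Suc j * ((h choose Suc j) * p ^ Suc j) = (Suc j * (h choose Suc j)) * p ^ Suc j"
      by (simp only: mult.assoc)
    also have "\<dots> = (p * (h - j)) * ((h choose j) * p ^ j)"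
      unfolding S by (simp add: mult_ac)
    also have "\<dots> \<le> (p * h - j) * ((p * h) choose j)"
    proof (intro mult_le_mono Suc.IH)
      have "j \<le> p * j" using that by simp
      thus "p * (h - j) \<le> p * h - j" by (simp add: right_diff_distrib' diff_le_mono2)
    qed
    also have "\<dots> = Suc j * ((p * h) choose Suc j)" by (rule S[symmetric])
    finally show ?thesis by (simp only: mult_le_cancel1)
  next
    case False
    hence "h choose Suc j = 0" by (intro binomial_eq_0) simp
    thus ?thesis by (simp only: mult_0)
  qed
qed simp

lemma finite_precomputed_sizes: "finite (precomputed_sizes t v)"
proof (rule finite_subset)
  show "precomputed_sizes t v \<subseteq> {..nat \<lceil>9 * ell t v\<rceil>}"
    by (auto simp: precomputed_sizes_def) linarith
qed auto

lemma hyperplanes_subset: "H \<in> hyperplanes t p \<Longrightarrow> H \<subseteq> AG t p"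
  by (auto simp: hyperplanes_def)

lemma card_in_hyperplanes: "prime p \<Longrightarrow> H \<in> hyperplanes t p \<Longrightarrow> card H = p ^ (t - 1)"
  using card_hyperplane by (auto simp: hyperplanes_eq)

text \<open>The ratio \<open>(h - t) / (P - t)\<close> lies between \<open>1 / (2 * p)\<close> and
  \<open>1 / p\<close>, so the window for the prime gives
  \<open>2 * ell \<le> \<mu> \<le> 8 * ell\<close>. A size outside the range from \<open>ell\<close>
  to \<open>9 * ell\<close> then deviates by at least \<open>ell - t \<ge> ell / 2\<close>, and
  \<open>\<mu> / (ell / 2)\<^sup>2 \<le> 32 / ell\<close>.\<close>

lemma bad_hyperplanes_le:
  assumes "admissible_prime t v p" "2 \<le> t" "2 * t + 2 \<le> p" "v \<le> p ^ t" "t + 2 \<le> v"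
    and ell_ge: "2 * real t \<le> ell t v" and H: "H \<in> hyperplanes t p"
  shows "(\<Sum>V\<in>nsets (AG t p) v. of_bool (card (H \<inter> V) \<notin> precomputed_sizes t v) * real (card (H \<inter> V) choose t)) \<le>
    real (p ^ t choose v) * hypergeom_moment (p ^ t) (p ^ (t - 1)) v t * (32 / ell t v)"
proof -
  have p: "prime p" and u: "4 * ell t v \<le> (real v - real t) / real p" "(real v - real t) / real p \<le> 8 * ell t v"
    using assms(1) by (auto simp: admissible_prime_def)
  define h P where "h = p ^ (t - 1)" and "P = p ^ t"
  have p1: "1 \<le> p" using assms by simp
  have Ph: "P = p * h" using assms(2) by (simp add: P_def h_def power_eq_if)
  have "p ^ 1 \<le> h" unfolding h_def using p1 assms(2) by (intro power_increasing) auto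
  hence h: "2 * t + 2 \<le> h" using assms(3) by simp
  define \<mu> where "\<mu> = (real h - real t) * (real v - real t) / (real P - real t)"
  have "1 * h \<le> P" unfolding Ph using p1 by (intro mult_right_mono) auto
  hence ptP: "real t < real P" using h by simp
  have "(real h - real t) / (real P - real t) \<le> 1 / real p"
  proof -
    have "1 * real t \<le> real p * real t" using p1 by (intro mult_right_mono) auto
    hence "real p * (real h - real t) \<le> real P - real t" by (simp add: Ph algebra_simps)
    thus ?thesis using ptP p1 by (simp add: field_simps)
  qed
  hence "(real h - real t) / (real P - real t) * (real v - real t) \<le> 1 / real p * (real v - real t)"
    using assms(5) by (intro mult_right_mono) auto
  hence \<mu>1: "\<mu> \<le> 8 * ell t v" using u(2) by (simp add: \<mu>_def)
  have "1 / (2 * real p) \<le> (real h - real t) / (real P - real t)"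
  proof -
    have "real p * (2 * real t) \<le> real p * real h" using h by (intro mult_left_mono) auto
    hence "real P - real t \<le> 2 * real p * (real h - real t)" by (simp add: Ph algebra_simps)
    thus ?thesis using ptP p1 by (simp add: field_simps)
  qed
  hence "1 / (2 * real p) * (real v - real t) \<le> (real h - real t) / (real P - real t) * (real v - real t)"
    using assms(5) by (intro mult_right_mono) auto
  hence \<mu>2: "2 * ell t v \<le> \<mu>" using u(1) by (simp add: \<mu>_def)
  have ell0: "0 < ell t v" using ell_ge assms(2) by linarith
  have "(\<Sum>V\<in>nsets (AG t p) v. of_bool (card (H \<inter> V) \<notin> precomputed_sizes t v) * real (card (H \<inter> V) choose t)) \<le>
      real (P choose v) * hypergeom_moment P h v t * (\<mu> / (ell t v / 2)\<^sup>2)"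
    unfolding \<mu>_def
  proof (rule sum_choose_Int_deviation)
    show "card (AG t p) = P" by (simp add: card_AG P_def)
    show "card H = h" using card_in_hyperplanes[OF p H] by (simp add: h_def)
    show "ell t v / 2 \<le> \<bar>real (card (H \<inter> V)) - real t -
        (real h - real t) * (real v - real t) / (real P - real t)\<bar>"
      if "card (H \<inter> V) \<notin> precomputed_sizes t v" for V
    proof -
      have "real (card (H \<inter> V)) \<le> ell t v \<or> 9 * ell t v \<le> real (card (H \<inter> V))"
        using that by (auto simp: precomputed_sizes_def)
      thus ?thesis using \<mu>1 \<mu>2 ell_ge ell0 unfolding \<mu>_def[symmetric] by linarith
    qed
  qed (use H hyperplanes_subset ell0 h assms in \<open>auto simp: finite_AG P_def\<close>)
  also have "\<dots> \<le> real (P choose v) * hypergeom_moment P h v t * (32 / ell t v)"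
    using \<mu>1 ell0 hypergeom_moment_nonneg
    by (intro mult_left_mono) (auto simp: power2_eq_square field_simps)
  finally show ?thesis by (simp add: P_def h_def)
qed

text \<open>The orderings are independent of \<open>V\<close>, so for fixed \<open>V\<close> and
  \<open>H\<close> they are averaged first, leaving multiples of
  \<open>card (H \<inter> V) choose t\<close>. The mean of the latter is the same for all
  hyperplanes; summed over them and divided by \<open>v choose t\<close>, it gives the factor
  \<open>p / (p - 1)\<close>.\<close>

lemma induced_density_expectation_le:
  assumes adm: "admissible_prime t v p" and t: "2 \<le> t" "t < k" and r: "1 \<le> r"
    and large: "2 * t + 2 \<le> p" "v \<le> p ^ t" "t + 2 \<le> v" "2 * real t \<le> ell t v"
    and \<epsilon>: "\<And>n. n \<in> precomputed_sizes t v \<Longrightarrow>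
      (\<Sum>\<sigma>\<in>permutations_of_set (nsets {..<n} k). real (num_uncovered {..<n} t \<sigma>)) /
        real (card (permutations_of_set (nsets {..<n} k))) \<le> \<epsilon> * real (n choose t)"
    and \<epsilon>0: "0 \<le> \<epsilon>"
    and out: "\<And>\<omega>. \<omega> \<in> set_pmf (induced_pmf v k t p r) \<Longrightarrow> induced_covering v k t p r \<omega> (out \<omega>)"
  defines "Q \<equiv> real (k choose t)"
  shows "\<forall>\<omega>\<in>set_pmf (induced_pmf v k t p r). is_covering (snd \<omega>) v k t (out \<omega>)"
    and "1 \<le> measure_pmf.expectation (induced_pmf v k t p r) (\<lambda>\<omega>. covering_density t (snd \<omega>) (out \<omega>))"
    and "measure_pmf.expectation (induced_pmf v k t p r) (\<lambda>\<omega>. covering_density t (snd \<omega>) (out \<omega>)) \<le>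
      (1 + 1 / (real p - 1)) * (1 + (Q - 1) * \<epsilon> + Q * 32 / ell t v)"
proof -
  let ?pre = "precomputed_sizes t v" and ?\<A> = "nsets (AG t p) v" and ?E = measure_pmf.expectation
  let ?P = "\<lambda>n. permutations_of_set (nsets {..<n::nat} k)"
  let ?I = "induced_pmf v k t p r"
  define S where "S = Pi_pmf (?pre \<times> {..<r}) [] (\<lambda>(n, i). pmf_of_set (?P n))"
  have p: "prime p" using adm by (simp add: admissible_prime_def)
  have \<A>: "finite ?\<A>" "?\<A> \<noteq> {}" "card ?\<A> = p ^ t choose v"
  proof -
    show "finite ?\<A>" using finite_AG by (rule finite_imp_finite_nsets)
    show c: "card ?\<A> = p ^ t choose v" by (simp add: card_nsets card_AG)
    have "0 < p ^ t choose v" using large(2) by (simp add: zero_less_binomial_iff)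
    thus "?\<A> \<noteq> {}" using c by (metis card.empty less_irrefl)
  qed
  have perms: "finite (?P n)" "?P n \<noteq> {}" "set_pmf (pmf_of_set (?P n)) = ?P n" for n
  proof -
    show 1: "finite (?P n)" by simp
    show 2: "?P n \<noteq> {}" by (simp add: finite_imp_finite_nsets)
    show "set_pmf (pmf_of_set (?P n)) = ?P n" using 1 2 by (rule set_pmf_of_set[rotated])
  qed
  have I: "?I = pair_pmf S (pmf_of_set ?\<A>)" by (simp add: induced_pmf_def S_def)
  have fin_pre: "finite (?pre \<times> {..<r})" using finite_precomputed_sizes by blast
  \<comment> \<open>The default \<open>[]\<close> outside the index set keeps the support finite, so
    all expectations are finite sums.\<close>
  have setS: "set_pmf S = PiE_dflt (?pre \<times> {..<r}) [] (\<lambda>(n, i). ?P n)"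
    unfolding S_def using fin_pre perms(3)
    by (subst set_Pi_pmf) (auto simp: PiE_dflt_def case_prod_unfold)
  have finS: "finite (set_pmf S)" unfolding setS using fin_pre perms(1) by (intro finite_PiE_dflt) auto
  have finI: "finite (set_pmf ?I)" unfolding I using finS \<A> by simp
  have setI: "set_pmf ?I = set_pmf S \<times> ?\<A>" unfolding I using \<A> by simp
  define bound where "bound = (\<lambda>(\<sigma> :: nat \<times> nat \<Rightarrow> nat set list) (V :: (nat \<Rightarrow> nat) set) H.
       if card (H \<inter> V) \<in> ?pre
       then real (card (H \<inter> V) choose t) +
         (Q - 1) * real (num_uncovered {..<card (H \<inter> V)} t (\<sigma> (card (H \<inter> V), 0)))
       else Q * real (card (H \<inter> V) choose t))"
  have point: "is_covering (snd \<omega>) v k t (out \<omega>) \<and>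
      Q * real (size (out \<omega>)) \<le> (\<Sum>H\<in>hyperplanes t p. bound (fst \<omega>) (snd \<omega>) H)"
    if \<omega>: "\<omega> \<in> set_pmf ?I" for \<omega>
  proof -
    obtain \<sigma> V where \<omega>': "\<omega> = (\<sigma>, V)" "\<sigma> \<in> set_pmf S" "V \<in> ?\<A>" using \<omega> setI by auto
    have "\<sigma> (n, i) \<in> ?P n" if "n \<in> ?pre" "i < r" for n i
      using \<omega>'(2) that unfolding setS PiE_dflt_def by auto
    thus ?thesis
      using induced_coveringD[of v k t p r \<sigma> V "out \<omega>"] out[OF \<omega>] \<omega>' p t r
      unfolding bound_def Q_def \<omega>'(1) fst_conv snd_conv by auto
  qed
  show cov: "\<forall>\<omega>\<in>set_pmf ?I. is_covering (snd \<omega>) v k t (out \<omega>)" using point by blast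
  have "1 \<le> covering_density t (snd \<omega>) (out \<omega>)" if "\<omega> \<in> set_pmf ?I" for \<omega>
    using bspec[OF cov that] large(3) by (intro covering_density_ge_1) auto
  hence "?E ?I (\<lambda>\<omega>. 1) \<le> ?E ?I (\<lambda>\<omega>. covering_density t (snd \<omega>) (out \<omega>))"
    by (intro integral_mono_AE integrable_measure_pmf_finite finI) (simp_all add: AE_measure_pmf_iff)
  thus "1 \<le> ?E ?I (\<lambda>\<omega>. covering_density t (snd \<omega>) (out \<omega>))" by simp
  define Cv where "Cv = real (v choose t)"
  have Cv: "0 < Cv" using large(3) by (simp add: Cv_def zero_less_binomial_iff)
  define m where "m = hypergeom_moment (p ^ t) (p ^ (t - 1)) v t"
  have m0: "0 \<le> m" unfolding m_def by (rule hypergeom_moment_nonneg)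
  have Q1: "1 \<le> Q" using t by (simp add: Q_def Suc_leI zero_less_binomial_iff)
  have "?E ?I (\<lambda>\<omega>. covering_density t (snd \<omega>) (out \<omega>)) \<le>
      ?E ?I (\<lambda>\<omega>. (\<Sum>H\<in>hyperplanes t p. bound (fst \<omega>) (snd \<omega>) H) / Cv)"
  proof (intro integral_mono_AE integrable_measure_pmf_finite finI)
    have "covering_density t (snd \<omega>) (out \<omega>) \<le> (\<Sum>H\<in>hyperplanes t p. bound (fst \<omega>) (snd \<omega>) H) / Cv"
      if \<omega>: "\<omega> \<in> set_pmf ?I" for \<omega>
    proof -
      have "covering_density t (snd \<omega>) (out \<omega>) = Q * real (size (out \<omega>)) / Cv"
        unfolding Q_def Cv_def using point[OF \<omega>] covering_density_eq[of "snd \<omega>" "out \<omega>" k t]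
        by (auto simp: is_covering_def)
      thus ?thesis using point[OF \<omega>] Cv by (simp add: divide_right_mono)
    qed
    thus "AE \<omega> in ?I. covering_density t (snd \<omega>) (out \<omega>) \<le>
        (\<Sum>H\<in>hyperplanes t p. bound (fst \<omega>) (snd \<omega>) H) / Cv" by (simp add: AE_measure_pmf_iff)
  qed
  also have "\<dots> = (\<Sum>H\<in>hyperplanes t p. \<Sum>V\<in>?\<A>. ?E S (\<lambda>\<sigma>. bound \<sigma> V H)) / real (p ^ t choose v) / Cv"
  proof -
    have int: "integrable (measure_pmf S) f" for f :: "_ \<Rightarrow> real"
      using finS by (rule integrable_measure_pmf_finite)
    have "?E ?I (\<lambda>\<omega>. (\<Sum>H\<in>hyperplanes t p. bound (fst \<omega>) (snd \<omega>) H) / Cv) =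
        ?E S (\<lambda>\<sigma>. (\<Sum>V\<in>?\<A>. (\<Sum>H\<in>hyperplanes t p. bound \<sigma> V H) / Cv) / real (p ^ t choose v))"
      unfolding I using finS \<A> by (simp add: expectation_pair_pmf_finite integral_pmf_of_set mult.commute flip: sum_divide_distrib)
    also have "\<dots> = (\<Sum>V\<in>?\<A>. (\<Sum>H\<in>hyperplanes t p. ?E S (\<lambda>\<sigma>. bound \<sigma> V H)) / Cv) / real (p ^ t choose v)"
      by (simp add: int)
    also have "\<dots> = (\<Sum>V\<in>?\<A>. \<Sum>H\<in>hyperplanes t p. ?E S (\<lambda>\<sigma>. bound \<sigma> V H)) / real (p ^ t choose v) / Cv"
      by (simp add: sum_divide_distrib[symmetric] mult.commute)
    also have "(\<Sum>V\<in>?\<A>. \<Sum>H\<in>hyperplanes t p. ?E S (\<lambda>\<sigma>. bound \<sigma> V H)) =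
        (\<Sum>H\<in>hyperplanes t p. \<Sum>V\<in>?\<A>. ?E S (\<lambda>\<sigma>. bound \<sigma> V H))" by (rule sum.swap)
    finally show ?thesis .
  qed
  also have "\<dots> \<le> (\<Sum>H\<in>hyperplanes t p. real (p ^ t choose v) * m * (1 + (Q - 1) * \<epsilon> + Q * 32 / ell t v)) /
      real (p ^ t choose v) / Cv"
  proof (intro divide_right_mono sum_mono)
    fix H assume H: "H \<in> hyperplanes t p"
    \<comment> \<open>For exceptional sizes the cost \<open>Q\<close> is added to the regular cost
      rather than replacing it, which leaves one sum without restriction and one covered by
      \<open>bad_hyperplanes_le\<close>.\<close>
    have "(\<Sum>V\<in>?\<A>. ?E S (\<lambda>\<sigma>. bound \<sigma> V H)) \<le>
        (\<Sum>V\<in>?\<A>. (1 + (Q - 1) * \<epsilon>) * real (card (H \<inter> V) choose t) +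
          Q * (of_bool (card (H \<inter> V) \<notin> ?pre) * real (card (H \<inter> V) choose t)))"
    proof (intro sum_mono)
      fix V assume "V \<in> ?\<A>"
      define n where "n = card (H \<inter> V)"
      show "?E S (\<lambda>\<sigma>. bound \<sigma> V H) \<le> (1 + (Q - 1) * \<epsilon>) * real (card (H \<inter> V) choose t) +
          Q * (of_bool (card (H \<inter> V) \<notin> ?pre) * real (card (H \<inter> V) choose t))"
      proof (cases "n \<in> ?pre")
        case True
        have comp: "map_pmf (\<lambda>\<sigma>. \<sigma> (n, 0)) S = pmf_of_set (?P n)"
          unfolding S_def using fin_pre True r by (subst Pi_pmf_component) auto
        have "?E S (\<lambda>\<sigma>. real (num_uncovered {..<n} t (\<sigma> (n, 0)))) =
            ?E (map_pmf (\<lambda>\<sigma>. \<sigma> (n, 0)) S) (\<lambda>\<tau>. real (num_uncovered {..<n} t \<tau>))" by simp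
        also have "\<dots> = (\<Sum>\<tau>\<in>?P n. real (num_uncovered {..<n} t \<tau>)) / real (card (?P n))"
          unfolding comp using perms by (intro integral_pmf_of_set) auto
        also have "\<dots> \<le> \<epsilon> * real (n choose t)" by (rule \<epsilon>[OF True])
        finally have E: "?E S (\<lambda>\<sigma>. real (num_uncovered {..<n} t (\<sigma> (n, 0)))) \<le> \<epsilon> * real (n choose t)" .
        have "?E S (\<lambda>\<sigma>. bound \<sigma> V H) =
            ?E S (\<lambda>\<sigma>. real (n choose t) + (Q - 1) * real (num_uncovered {..<n} t (\<sigma> (n, 0))))"
          using True by (simp add: bound_def n_def)
        also have "\<dots> = real (n choose t) + (Q - 1) * ?E S (\<lambda>\<sigma>. real (num_uncovered {..<n} t (\<sigma> (n, 0))))"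
          using finS by (simp add: integrable_measure_pmf_finite)
        also have "\<dots> \<le> real (n choose t) + (Q - 1) * (\<epsilon> * real (n choose t))"
          using E Q1 by (intro add_left_mono mult_left_mono) auto
        finally show ?thesis using True by (simp add: n_def algebra_simps)
      next
        case False
        hence "?E S (\<lambda>\<sigma>. bound \<sigma> V H) = Q * real (n choose t)" by (simp add: bound_def n_def)
        thus ?thesis using False Q1 \<epsilon>0 by (simp add: n_def)
      qed
    qed
    also have "\<dots> = (1 + (Q - 1) * \<epsilon>) * (\<Sum>V\<in>?\<A>. real (card (H \<inter> V) choose t)) +
        Q * (\<Sum>V\<in>?\<A>. of_bool (card (H \<inter> V) \<notin> ?pre) * real (card (H \<inter> V) choose t))"
      by (simp only: sum.distrib sum_distrib_left)
    also have "(\<Sum>V\<in>?\<A>. real (card (H \<inter> V) choose t)) = real (p ^ t choose v) * m"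
      unfolding m_def using H p large hyperplanes_subset card_in_hyperplanes
      by (intro sum_choose_Int finite_AG card_AG) auto
    also have "(1 + (Q - 1) * \<epsilon>) * \<dots> +
        Q * (\<Sum>V\<in>?\<A>. of_bool (card (H \<inter> V) \<notin> ?pre) * real (card (H \<inter> V) choose t)) \<le>
      (1 + (Q - 1) * \<epsilon>) * (real (p ^ t choose v) * m) + Q * (real (p ^ t choose v) * m * (32 / ell t v))"
      using bad_hyperplanes_le[OF adm t(1) large H] Q1 unfolding m_def
      by (intro add_left_mono mult_left_mono) auto
    finally show "(\<Sum>V\<in>?\<A>. ?E S (\<lambda>\<sigma>. bound \<sigma> V H)) \<le>
        real (p ^ t choose v) * m * (1 + (Q - 1) * \<epsilon> + Q * 32 / ell t v)"
      by (simp add: algebra_simps)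
  qed (use Cv in auto)
  also have "(\<Sum>H\<in>hyperplanes t p. real (p ^ t choose v) * m * (1 + (Q - 1) * \<epsilon> + Q * 32 / ell t v)) /
      real (p ^ t choose v) / Cv =
      (real (card (hyperplanes t p)) * m / Cv) * (1 + (Q - 1) * \<epsilon> + Q * 32 / ell t v)"
    using \<A> large(2) by (simp add: zero_less_binomial_iff)
  also have "\<dots> \<le> (1 + 1 / (real p - 1)) * (1 + (Q - 1) * \<epsilon> + Q * 32 / ell t v)"
  proof (intro mult_right_mono)
    have p2: "2 \<le> p" using large(1) t(1) by simp
    have P0: "0 < p ^ t" using p2 by simp
    have Pp: "p ^ t = p * p ^ (t - 1)" using t(1) by (simp add: power_eq_if)
    have c0: "0 < real (p ^ t choose t)"
      using large(2,3) by (simp add: zero_less_binomial_iff)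
    have "(p ^ (t - 1) choose t) * p ^ t \<le> (p ^ t choose t)"
      using binomial_mult_power_le[of p "p ^ (t - 1)" t] p2 Pp by simp
    hence "real ((p ^ (t - 1) choose t) * p ^ t) \<le> real (p ^ t choose t)" by (rule of_nat_mono)
    hence ratio: "real (p ^ (t - 1) choose t) / real (p ^ t choose t) \<le> 1 / real (p ^ t)"
      using c0 P0 by (simp add: field_simps)
    have "real ((p - 1) * card (hyperplanes t p)) \<le> real (p * (p ^ t - 1))"
      using card_hyperplanes_le[OF p] by (rule of_nat_mono)
    also have "\<dots> \<le> real p * real (p ^ t)" using P0 by (simp add: mult_left_mono)
    finally have "real (card (hyperplanes t p)) \<le> real p * real (p ^ t) / (real p - 1)"
      using p2 by (simp add: of_nat_diff field_simps)
    hence "real (card (hyperplanes t p)) * (real (p ^ (t - 1) choose t) / real (p ^ t choose t)) \<le>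
        real p * real (p ^ t) / (real p - 1) * (1 / real (p ^ t))"
      using ratio p2 by (intro mult_mono) auto
    also have "\<dots> = 1 + 1 / (real p - 1)" using P0 p2 by (simp add: field_simps)
    finally show "real (card (hyperplanes t p)) * m / Cv \<le> 1 + 1 / (real p - 1)"
      using Cv by (simp add: m_def hypergeom_moment_def Cv_def)
    show "0 \<le> 1 + (Q - 1) * \<epsilon> + Q * 32 / ell t v" using Q1 \<epsilon>0 large(4) by simp
  qed
  finally show "?E ?I (\<lambda>\<omega>. covering_density t (snd \<omega>) (out \<omega>)) \<le>
      (1 + 1 / (real p - 1)) * (1 + (Q - 1) * \<epsilon> + Q * 32 / ell t v)" .
qed

text \<open>\<open>out\<close> resolves the open choices of the algorithm in an arbitrary way that
  may depend on the whole outcome, and \<open>K\<close> is chosen before the numbers of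
  runs.\<close>

theorem corollary4:
  fixes k t :: nat and D :: real
  assumes "2 \<le> t" and "t < k"
    and "D = real (k choose t) - 1"
  shows "\<exists>K::real. \<forall>r :: nat \<Rightarrow> nat.
    (\<forall>v. 1 \<le> r v) \<and> (\<lambda>v. real (r v)) \<in> O(\<lambda>v. ln (ell t v)) \<longrightarrow>
    (\<forall>\<^sub>F v in sequentially. \<forall>p (out :: outcome \<Rightarrow> (nat \<Rightarrow> nat) set multiset).
       admissible_prime t v p \<and>
       (\<forall>\<omega>\<in>set_pmf (induced_pmf v k t p (r v)). induced_covering v k t p (r v) \<omega> (out \<omega>)) \<longrightarrow>
       (\<forall>\<omega>\<in>set_pmf (induced_pmf v k t p (r v)). is_covering (snd \<omega>) v k t (out \<omega>)) \<and>
       \<bar>measure_pmf.expectation (induced_pmf v k t p (r v))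
         (\<lambda>\<omega>. covering_density t (snd \<omega>) (out \<omega>)) - 1\<bar>
         \<le> K * ln (real v) powr (- 1 / D))"
proof -
  define Q where "Q = real (k choose t)"
  have D: "D = Q - 1" "1 \<le> D"
  proof -
    show "D = Q - 1" using assms(3) by (simp add: Q_def)
    have "k - t < k choose t" using assms by (intro binomial_gt_diff) auto
    thus "1 \<le> D" using assms by simp
  qed
  obtain K0 where K0: "0 \<le> K0" "\<forall>\<^sub>F n in sequentially.
    (\<Sum>\<sigma>\<in>permutations_of_set (nsets {..<n} k). real (num_uncovered {..<n} t \<sigma>)) /
      real (card (permutations_of_set (nsets {..<n} k))) \<le>
    K0 * ln (real n) powr (- 1 / D) * real (n choose t)"
    using greedy_uncovered_asymptotics[of t k] assms by auto
  then obtain N0 where N0: "\<And>n. N0 \<le> n \<Longrightarrow>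
    (\<Sum>\<sigma>\<in>permutations_of_set (nsets {..<n} k). real (num_uncovered {..<n} t \<sigma>)) /
      real (card (permutations_of_set (nsets {..<n} k))) \<le>
    K0 * ln (real n) powr (- 1 / D) * real (n choose t)"
    unfolding eventually_sequentially by blast
  \<comment> \<open>Precomputed sizes exceed \<open>v powr (1 / 4)\<close>, so their logarithm is at
    least \<open>ln v / 4\<close>; the second factor converts the rate in \<open>n\<close> into one
    in \<open>v\<close>.\<close>
  define K' where "K' = K0 * (1 / 4) powr (- 1 / D)"
  have K': "0 \<le> K'" using K0 by (simp add: K'_def)
  define B where "B = D * K' + 32 * Q"
  have B0: "0 \<le> B" using D K' by (simp add: B_def)
  \<comment> \<open>As \<open>t \<ge> 2\<close>, the exponent \<open>1 - c\<close> of
    \<open>ell\<close> is at least \<open>1 / 2\<close>; lower bounds for \<open>ell\<close> can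
    thus be stated with \<open>v powr (1 / 2)\<close>.\<close>
  define c where "c = 1 / real t"
  have c: "0 < c" "c \<le> 1 / 2" using assms(1) by (auto simp: c_def field_simps)
  have "\<forall>\<^sub>F v in sequentially. real N0 + 2 * real t \<le> 1 / 9 * real v powr (1 / 2)"
    by real_asymp
  moreover have "\<forall>\<^sub>F v in sequentially. real v powr (1 / 4) \<le> 1 / 9 * real v powr (1 / 2)"
    by real_asymp
  moreover have "\<forall>\<^sub>F v in sequentially. ln (real v) \<le> 1 / 9 * real v powr (1 / 2)"
    by real_asymp
  moreover have "\<forall>\<^sub>F v in sequentially. 2 * real t + 2 \<le> real v powr c"
    using c by real_asymp
  moreover have "\<forall>\<^sub>F v in sequentially. ln (real v) \<le> real v powr c - 1"
    using c by real_asymp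
  moreover have "\<forall>\<^sub>F v in sequentially. 9 * t + 3 \<le> v"
    by (rule eventually_ge_at_top)
  ultimately have ev: "\<forall>\<^sub>F v in sequentially. \<forall>r p (out :: outcome \<Rightarrow> (nat \<Rightarrow> nat) set multiset).
       1 \<le> r \<and> admissible_prime t v p \<and>
       (\<forall>\<omega>\<in>set_pmf (induced_pmf v k t p r). induced_covering v k t p r \<omega> (out \<omega>)) \<longrightarrow>
       (\<forall>\<omega>\<in>set_pmf (induced_pmf v k t p r). is_covering (snd \<omega>) v k t (out \<omega>)) \<and>
       \<bar>measure_pmf.expectation (induced_pmf v k t p r)
         (\<lambda>\<omega>. covering_density t (snd \<omega>) (out \<omega>)) - 1\<bar>
         \<le> (1 + 2 * B) * ln (real v) powr (- 1 / D)"
  proof eventually_elim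
    case (elim v)
    define w where "w = ln (real v) powr (- 1 / D)"
    have v: "3 \<le> v" "9 * real t \<le> real v" "t + 2 \<le> v" using elim(6) by linarith+
    have "exp 1 \<le> real v" using exp_le v(1) by linarith
    hence ln1: "1 \<le> ln (real v)" using v(1) by (subst ln_ge_iff) auto
    have w: "0 \<le> w" "w \<le> 1" "1 / ln (real v) \<le> w"
    proof -
      show "w \<le> 1" unfolding w_def using ln1 D(2) powr_mono[of "- 1 / D" 0 "ln (real v)"] by simp
      have "1 / ln (real v) = ln (real v) powr (- 1)" using ln1 by (simp add: powr_minus_divide)
      also have "\<dots> \<le> w" unfolding w_def using D ln1 by (intro powr_mono) (auto simp: field_simps)
      finally show "1 / ln (real v) \<le> w" .
    qed (simp add: w_def)
    have ell: "ell t v = 1 / 9 * real v powr (1 - c)" by (simp add: ell_def c_def)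
    have "real v powr (1 / 2) \<le> real v powr (1 - c)" using c v by (intro powr_mono) auto
    hence ell_ge: "real N0 + 2 * real t \<le> ell t v" "real v powr (1 / 4) \<le> ell t v" "ln (real v) \<le> ell t v"
      using elim(1-3) unfolding ell by linarith+
    show ?case
    proof (intro allI impI, elim conjE)
      fix r p and out :: "outcome \<Rightarrow> (nat \<Rightarrow> nat) set multiset"
      assume r: "1 \<le> r" and adm: "admissible_prime t v p"
        and out: "\<forall>\<omega>\<in>set_pmf (induced_pmf v k t p r). induced_covering v k t p r \<omega> (out \<omega>)"
      have p0: "0 < real p" and u: "(real v - real t) / real p \<le> 8 * ell t v"
        using adm prime_gt_0_nat by (auto simp: admissible_prime_def)
      have vpow: "real v powr (1 - c) * real v powr c = real v"
        using v(1) by (simp flip: powr_add)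
      \<comment> \<open>Here \<open>8 * ell\<close> is \<open>8 / 9 * v powr (1 - c)\<close>, while
        \<open>9 * t \<le> v\<close> makes the left side at least \<open>8 / 9 * v\<close>. The
        constants cancel and leave \<open>p \<ge> v powr (1 / t)\<close>, hence enough points in the
        affine space.\<close>
      have "real v - real t \<le> 8 * ell t v * real p" using u p0 by (simp add: field_simps)
      hence "real v \<le> real v powr (1 - c) * real p" using v(2) unfolding ell by simp
      hence "real v powr (1 - c) * real v powr c \<le> real v powr (1 - c) * real p" using vpow by simp
      hence pc: "real v powr c \<le> real p" using v(1) by simp
      have "real v = (real v powr c) ^ t"
        using v(1) assms(1) by (simp add: c_def powr_powr flip: powr_realpow)
      also have "\<dots> \<le> real p ^ t" using pc by (intro power_mono) auto
      finally have "real v \<le> real (p ^ t)" by simp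
      hence vp: "v \<le> p ^ t" by (simp only: of_nat_le_iff)
      have p2: "2 * t + 2 \<le> p" using pc elim(4) by linarith
      have eps: "(\<Sum>\<sigma>\<in>permutations_of_set (nsets {..<n} k). real (num_uncovered {..<n} t \<sigma>)) /
          real (card (permutations_of_set (nsets {..<n} k))) \<le> K' * w * real (n choose t)"
        if n: "n \<in> precomputed_sizes t v" for n
      proof -
        have n': "ell t v < real n" using n by (simp add: precomputed_sizes_def)
        hence "real N0 \<le> real n" using ell_ge(1) by linarith
        hence "N0 \<le> n" by simp
        have "ln (real v powr (1 / 4)) \<le> ln (real n)"
          using n' ell_ge(2) v(1) by (intro ln_mono) auto
        hence "1 / 4 * ln (real v) \<le> ln (real n)" using v(1) by (simp add: ln_powr)
        hence "ln (real n) powr (- 1 / D) \<le> (1 / 4 * ln (real v)) powr (- 1 / D)"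
          using ln1 D(2) by (intro powr_mono2') auto
        also have "\<dots> = (1 / 4) powr (- 1 / D) * w" unfolding w_def using ln1 by (intro powr_mult)
        finally have "K0 * ln (real n) powr (- 1 / D) \<le> K' * w"
          unfolding K'_def using K0(1) by (simp add: mult_left_mono mult.assoc)
        hence "K0 * ln (real n) powr (- 1 / D) * real (n choose t) \<le> K' * w * real (n choose t)"
          by (intro mult_right_mono) auto
        thus ?thesis using N0[OF \<open>N0 \<le> n\<close>] by linarith
      qed
      let ?E = "measure_pmf.expectation (induced_pmf v k t p r) (\<lambda>\<omega>. covering_density t (snd \<omega>) (out \<omega>))"
      have ell2: "2 * real t \<le> ell t v" using ell_ge(1) by linarith
      have eps0: "0 \<le> K' * w" using K' w by simp
      note main = induced_density_expectation_le[OF adm assms(1,2) r p2 vp v(3) ell2 eps eps0 bspec[OF out]]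
      have "?E \<le> (1 + 1 / (real p - 1)) * (1 + D * (K' * w) + Q * 32 / ell t v)"
        using main(3) unfolding D(1) Q_def .
      also have "\<dots> \<le> (1 + w) * (1 + B * w)"
      proof (intro mult_mono)
        have "1 / (real p - 1) \<le> 1 / ln (real v)"
          using pc elim(5) ln1 by (intro divide_left_mono) auto
        thus "1 + 1 / (real p - 1) \<le> 1 + w" using w(3) by linarith
        have "Q * 32 / ell t v \<le> Q * 32 * (1 / ln (real v))"
          using ell_ge(3) ln1 D by (simp add: divide_left_mono)
        also have "\<dots> \<le> Q * 32 * w" using w(3) D by (intro mult_left_mono) auto
        finally show "1 + D * (K' * w) + Q * 32 / ell t v \<le> 1 + B * w"
          by (simp add: B_def algebra_simps)
        show "0 \<le> 1 + D * (K' * w) + Q * 32 / ell t v" using eps0 D ell2 by simp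
      qed (use w in auto)
      also have "\<dots> = 1 + (w + B * w) + B * w * w" by (simp add: algebra_simps)
      \<comment> \<open>The quadratic term is bounded with \<open>w \<le> 1\<close>, whence the
        constant \<open>1 + 2 * B\<close>.\<close>
      also have "\<dots> \<le> 1 + (w + B * w) + B * w * 1"
        using B0 w by (intro add_left_mono mult_left_mono) auto
      finally have "?E \<le> 1 + (1 + 2 * B) * w" by (simp add: algebra_simps)
      thus "(\<forall>\<omega>\<in>set_pmf (induced_pmf v k t p r). is_covering (snd \<omega>) v k t (out \<omega>)) \<and>
          \<bar>?E - 1\<bar> \<le> (1 + 2 * B) * ln (real v) powr (- 1 / D)"
        using main(1,2) unfolding w_def by auto
    qed
  qed
  show ?thesis
  proof (intro exI[of _ "1 + 2 * B"] allI impI)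
    fix r :: "nat \<Rightarrow> nat"
    assume "(\<forall>v. 1 \<le> r v) \<and> (\<lambda>v. real (r v)) \<in> O(\<lambda>v. ln (ell t v))"
    hence r: "1 \<le> r v" for v by blast
    show "\<forall>\<^sub>F v in sequentially. \<forall>p (out :: outcome \<Rightarrow> (nat \<Rightarrow> nat) set multiset).
       admissible_prime t v p \<and>
       (\<forall>\<omega>\<in>set_pmf (induced_pmf v k t p (r v)). induced_covering v k t p (r v) \<omega> (out \<omega>)) \<longrightarrow>
       (\<forall>\<omega>\<in>set_pmf (induced_pmf v k t p (r v)). is_covering (snd \<omega>) v k t (out \<omega>)) \<and>
       \<bar>measure_pmf.expectation (induced_pmf v k t p (r v))
         (\<lambda>\<omega>. covering_density t (snd \<omega>) (out \<omega>)) - 1\<bar>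
         \<le> (1 + 2 * B) * ln (real v) powr (- 1 / D)"
      using ev by eventually_elim (use r in blast)
  qed
qed

end
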